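(* Let $\Gamma$ be a countable discrete sofic group with sofic approximation $\Sigma$. Let $X$ be a Polish space with $\Gamma\curvearrowright X$ by homeomorphisms and let $\mu$ be a $\Gamma$-invariant Borel probability measure on $X$. For any dynamically generating pseudometric $\Delta$ on $X$ we have $$h_{\Sigma,\mu}(\Delta)=h_{\Sigma,\mu}(X,\Gamma).$$
   Context: Sofic approximations. $u_d$ is the uniform probability measure on $\{1,\dots,d\}$ and $S_d$ is the symmetric group. A sofic approximation of a countable discrete group $\Gamma$ is a sequence $\Sigma=(\sigma_i\colon\Gamma\to S_{d_i})$ of functions (not assumed homomorphisms) such that $u_{d_i}(\{k:\sigma_i(g)\sigma_i(h)(k)=\sigma_i(gh)(k)\})\to1$ for all $g,h\in\Gamma$ and $u_{d_i}(\{k:\sigma_i(g)(k)\neq\sigma_i(h)(k)\})\to1$ for all $g\neq h$ in $\Gamma$. $\Gamma$ is sofic if it has a sofic approximation. Dynamically generating. A bounded continuous pseudometric $\Delta$ on $X$ is dynamically generating if for any $x\in X$ and any open neighborhood $U$ of $x$ there are $\delta>0$ and a finite $F\subseteq\Gamma$ such that if $y\in X$ and $\max_{g\in F}\Delta(gx,gy)<\delta$, then $y\in U$. Entropy via a Polish model. On $X^d$ (functions $\{1,\dots,d\}\to X$) put $\Delta_2(\phi,\psi)^2=\frac1d\sum_{j=1}^d\Delta(\phi(j),\psi(j))^2$. For $\sigma\colon\Gamma\to S_d$, finite $F\subseteq\Gamma$, $\delta>0$ and finite $L\subseteq C_b(X)$ (bounded continuous functions), $\mathrm{Map}_\mu(\Delta,F,\delta,L,\sigma)$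 is the set of all $\phi\colon\{1,\dots,d\}\to X$ with $\max_{g\in F}\Delta_2(\phi\circ\sigma(g),g\phi)<\delta$ and $\left|\int f\,d\phi_*(u_d)-\int f\,d\mu\right|<\delta$ for all $f\in L$. For a pseudometric space $(A,\Delta)$, $N_\varepsilon(A,\Delta)$ is the largest cardinality of a subset $N\subseteq A$ with $\Delta(n_1,n_2)>\varepsilon$ for all $n_1\neq n_2$ in $N$. With $\log0=-\infty$, put $$h_{\Sigma,\mu}(\Delta,\varepsilon,F,\delta,L)=\limsup_{i\to\infty}\frac1{d_i}\log N_\varepsilon(\mathrm{Map}_\mu(\Delta,F,\delta,L,\sigma_i),\Delta_2),$$ $$h_{\Sigma,\mu}(\Delta,\varepsilon)=\inf_{F,\delta,L}h_{\Sigma,\mu}(\Delta,\varepsilon,F,\delta,L),\qquad h_{\Sigma,\mu}(\Delta)=\sup_{\varepsilon>0}h_{\Sigma,\mu}(\Delta,\varepsilon),$$ the infimum being over finite $F\subseteq\Gamma$, $\delta>0$, finite $L\subseteq C_b(X)$. Sofic measure entropy (Bowen, Kerr–Li; in Kerr's formulation). A finite observable on $X$ is a measurable map $\alpha\colon X\to A$ with $A$ finite. A finite observable $\beta\colon X\to B$ refines $\alpha$, written $\alpha\le\beta$, if there is $\pi\colon B\to A$ with $\pi(\beta(x))=\alpha(x)$ for a.e. $x$. For finite $F\subseteq\Gamma$, let $\widetilde{\beta}^{F}\colon X\to B^F$, $\widetilde\beta^F(x)(g)=\beta(g^{-1}x)$. For finite $F\subseteq \Gamma$ containing the identity $e$,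 $\delta>0$ and $\sigma\colon\Gamma\to S_d$, let $\mathrm{AP}(\beta,F,\delta,\sigma)$ be the set of all $\phi\colon\{1,\dots,d\}\to B^F$ with $$\sum_{b\in B^F}\left|u_d(\phi^{-1}(\{b\}))-\mu((\widetilde\beta^F)^{-1}(\{b\}))\right|<\delta,\qquad u_d(\{j:\phi(j)(g)\neq\phi(\sigma(g)^{-1}(j))(e)\})<\delta\ \text{ for all } g\in F.$$ Let $\pi^*\colon B^F\to A$, $\pi^*(b)=\pi(b(e))$. Put $$h_{\Sigma,\mu}(\alpha;\beta,F,\delta)=\limsup_{i\to\infty}\frac1{d_i}\log\left|\{\pi^*\circ\phi:\phi\in\mathrm{AP}(\beta,F,\delta,\sigma_i)\}\right|,\qquad h_{\Sigma,\mu}(\alpha;\beta)=\inf_{F,\delta}h_{\Sigma,\mu}(\alpha;\beta,F,\delta),$$ and $h_{\Sigma,\mu}(X,\Gamma)=\sup_\alpha\inf_{\beta\ge\alpha}h_{\Sigma,\mu}(\alpha;\beta)$, over all finite observables $\alpha$ and finite observables $\beta$ refining $\alpha$. (Kerr: if $\mathcal S$ is a subalgebra of the measurable sets whose $\Gamma$-translates generate the measurable sets up to null sets, the same value results from restricting $\alpha,\beta$ to $\mathcal S$-measurable observables.) *)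

theory Defs
  imports "HOL-Probability.Probability" "HOL-Algebra.Group_Action"
begin

text \<open>The uniform probability measure on \<open>{1..d}\<close>; meaningful only for \<open>d > 0\<close>, which every
  use below guarantees. Push-forwards of it are formed with \<open>map_pmf\<close>.\<close>

definition unif :: "nat \<Rightarrow> nat pmf" where
  "unif d = pmf_of_set {1..d}"

definition sofic_approximation ::
  "('g, 'm) monoid_scheme \<Rightarrow> (nat \<Rightarrow> nat) \<Rightarrow> (nat \<Rightarrow> 'g \<Rightarrow> nat \<Rightarrow> nat) \<Rightarrow> bool" where
  "sofic_approximation G d \<sigma> \<longleftrightarrow>
     (\<forall>i. d i > 0) \<and>
     (\<forall>i. \<forall>g\<in>carrier G. \<sigma> i g permutes {1..d i}) \<and>
     (\<forall>g\<in>carrier G. \<forall>h\<in>carrier G.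
        (\<lambda>i. measure_pmf.prob (unif (d i)) {k. \<sigma> i g (\<sigma> i h k) = \<sigma> i (g \<otimes>\<^bsub>G\<^esub> h) k})
          \<longlonglongrightarrow> 1) \<and>
     (\<forall>g\<in>carrier G. \<forall>h\<in>carrier G. g \<noteq> h \<longrightarrow>
        (\<lambda>i. measure_pmf.prob (unif (d i)) {k. \<sigma> i g k \<noteq> \<sigma> i h k}) \<longlonglongrightarrow> 1)"

text \<open>The logarithm of a cardinality, with \<open>log 0 = -\<infinity>\<close> and \<open>log \<infinity> = \<infinity>\<close>.\<close>

definition log_card :: "enat \<Rightarrow> ereal" where
  "log_card n = (case n of enat k \<Rightarrow> (if k = 0 then -\<infinity> else ereal (ln (real k))) | \<infinity> \<Rightarrow> \<infinity>)"


section \<open>Entropy of a dynamically generating pseudometric\<close>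

definition continuous_action ::
  "('g, 'm) monoid_scheme \<Rightarrow> ('g \<Rightarrow> 'x::topological_space \<Rightarrow> 'x) \<Rightarrow> bool" where
  "continuous_action G act \<longleftrightarrow>
     group_action G UNIV act \<and>
     (\<forall>g\<in>carrier G. homeomorphism UNIV UNIV (act g) (act (inv\<^bsub>G\<^esub> g)))"

definition invariant_prob ::
  "('g, 'm) monoid_scheme \<Rightarrow> ('g \<Rightarrow> 'x::topological_space \<Rightarrow> 'x) \<Rightarrow> 'x measure \<Rightarrow> bool" where
  "invariant_prob G act \<mu> \<longleftrightarrow>
     prob_space \<mu> \<and> sets \<mu> = sets borel \<and> (\<forall>g\<in>carrier G. distr \<mu> borel (act g) = \<mu>)"

definition bounded_continuous_pseudometric :: "('x::topological_space \<Rightarrow> 'x \<Rightarrow> real) \<Rightarrow> bool" where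
  "bounded_continuous_pseudometric \<Delta> \<longleftrightarrow>
     (\<forall>x y. 0 \<le> \<Delta> x y) \<and>
     (\<forall>x. \<Delta> x x = 0) \<and>
     (\<forall>x y. \<Delta> x y = \<Delta> y x) \<and>
     (\<forall>x y z. \<Delta> x z \<le> \<Delta> x y + \<Delta> y z) \<and>
     (\<exists>C. \<forall>x y. \<Delta> x y \<le> C) \<and>
     continuous_on UNIV (\<lambda>(x, y). \<Delta> x y)"

text \<open>Here and in \<open>Map_mu\<close>, strict bounds on a maximum over \<open>F\<close> are written as a
  bounded quantifier; they are vacuous for \<open>F = {}\<close>.\<close>

definition dynamically_generating ::
  "('g, 'm) monoid_scheme \<Rightarrow> ('g \<Rightarrow> 'x::topological_space \<Rightarrow> 'x) \<Rightarrow> ('x \<Rightarrow> 'x \<Rightarrow> real) \<Rightarrow> bool" where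
  "dynamically_generating G act \<Delta> \<longleftrightarrow>
     bounded_continuous_pseudometric \<Delta> \<and>
     (\<forall>x U. open U \<and> x \<in> U \<longrightarrow>
        (\<exists>\<delta>>0. \<exists>F. finite F \<and> F \<subseteq> carrier G \<and>
           (\<forall>y. (\<forall>g\<in>F. \<Delta> (act g x) (act g y) < \<delta>) \<longrightarrow> y \<in> U)))"

definition Delta2 ::
  "('x \<Rightarrow> 'x \<Rightarrow> real) \<Rightarrow> nat \<Rightarrow> (nat \<Rightarrow> 'x) \<Rightarrow> (nat \<Rightarrow> 'x) \<Rightarrow> real" where
  "Delta2 \<Delta> d \<phi> \<psi> = sqrt (1 / real d * (\<Sum>j=1..d. (\<Delta> (\<phi> j) (\<psi> j))\<^sup>2))"

definition Map_mu ::
  "('g \<Rightarrow> 'x::topological_space \<Rightarrow> 'x) \<Rightarrow> 'x measure \<Rightarrow> ('x \<Rightarrow> 'x \<Rightarrow> real) \<Rightarrow> 'g set \<Rightarrow> real \<Rightarrow>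
   ('x \<Rightarrow>\<^sub>C real) set \<Rightarrow> nat \<Rightarrow> ('g \<Rightarrow> nat \<Rightarrow> nat) \<Rightarrow> (nat \<Rightarrow> 'x) set" where
  "Map_mu act \<mu> \<Delta> F \<delta> L d \<sigma> =
     {\<phi> \<in> {1..d} \<rightarrow>\<^sub>E UNIV.
        (\<forall>g\<in>F. Delta2 \<Delta> d (\<phi> \<circ> \<sigma> g) (act g \<circ> \<phi>) < \<delta>) \<and>
        (\<forall>f\<in>L. \<bar>measure_pmf.expectation (map_pmf \<phi> (unif d)) (apply_bcontfun f)
               - (\<integral>x. apply_bcontfun f x \<partial>\<mu>)\<bar> < \<delta>)}"

text \<open>The largest cardinality of an \<open>\<epsilon>\<close>-separated subset, \<open>\<infinity>\<close> if there is no largest one.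
  Subsets of separated sets are separated, so finite ones suffice.\<close>

definition sep_number :: "real \<Rightarrow> 'a set \<Rightarrow> ('a \<Rightarrow> 'a \<Rightarrow> real) \<Rightarrow> enat" where
  "sep_number \<epsilon> A \<rho> =
     (SUP N \<in> {N. N \<subseteq> A \<and> finite N \<and> (\<forall>x\<in>N. \<forall>y\<in>N. x \<noteq> y \<longrightarrow> \<rho> x y > \<epsilon>)}. enat (card N))"

definition h_Delta_loc ::
  "(nat \<Rightarrow> nat) \<Rightarrow> (nat \<Rightarrow> 'g \<Rightarrow> nat \<Rightarrow> nat) \<Rightarrow> ('g \<Rightarrow> 'x::topological_space \<Rightarrow> 'x) \<Rightarrow> 'x measure \<Rightarrow>
   ('x \<Rightarrow> 'x \<Rightarrow> real) \<Rightarrow> real \<Rightarrow> 'g set \<Rightarrow> real \<Rightarrow> ('x \<Rightarrow>\<^sub>C real) set \<Rightarrow> ereal" where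
  "h_Delta_loc d \<sigma> act \<mu> \<Delta> \<epsilon> F \<delta> L =
     limsup (\<lambda>i. ereal (1 / real (d i)) *
       log_card (sep_number \<epsilon> (Map_mu act \<mu> \<Delta> F \<delta> L (d i) (\<sigma> i)) (Delta2 \<Delta> (d i))))"

definition h_Delta_eps ::
  "('g, 'm) monoid_scheme \<Rightarrow> (nat \<Rightarrow> nat) \<Rightarrow> (nat \<Rightarrow> 'g \<Rightarrow> nat \<Rightarrow> nat) \<Rightarrow>
   ('g \<Rightarrow> 'x::topological_space \<Rightarrow> 'x) \<Rightarrow> 'x measure \<Rightarrow> ('x \<Rightarrow> 'x \<Rightarrow> real) \<Rightarrow> real \<Rightarrow> ereal" where
  "h_Delta_eps G d \<sigma> act \<mu> \<Delta> \<epsilon> =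
     (INF F \<in> {F. finite F \<and> F \<subseteq> carrier G}. INF \<delta> \<in> {0<..}. INF L \<in> {L. finite L}.
        h_Delta_loc d \<sigma> act \<mu> \<Delta> \<epsilon> F \<delta> L)"

definition h_Delta ::
  "('g, 'm) monoid_scheme \<Rightarrow> (nat \<Rightarrow> nat) \<Rightarrow> (nat \<Rightarrow> 'g \<Rightarrow> nat \<Rightarrow> nat) \<Rightarrow>
   ('g \<Rightarrow> 'x::topological_space \<Rightarrow> 'x) \<Rightarrow> 'x measure \<Rightarrow> ('x \<Rightarrow> 'x \<Rightarrow> real) \<Rightarrow> ereal" where
  "h_Delta G d \<sigma> act \<mu> \<Delta> = (SUP \<epsilon> \<in> {0<..}. h_Delta_eps G d \<sigma> act \<mu> \<Delta> \<epsilon>)"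


section \<open>Sofic measure entropy\<close>

text \<open>A finite observable is a pair of a finite label set and a measurable map into it.\<close>

definition observable :: "'x measure \<Rightarrow> 'a set \<Rightarrow> ('x \<Rightarrow> 'a) \<Rightarrow> bool" where
  "observable \<mu> A \<alpha> \<longleftrightarrow> finite A \<and> \<alpha> \<in> measurable \<mu> (count_space A)"

text \<open>\<open>\<beta>\<close> refines \<open>\<alpha>\<close> if such a \<open>\<pi>\<close> exists; it is determined on labels of positive measure.\<close>

definition refines_via ::
  "'x measure \<Rightarrow> 'a set \<Rightarrow> ('x \<Rightarrow> 'a) \<Rightarrow> 'b set \<Rightarrow> ('x \<Rightarrow> 'b) \<Rightarrow> ('b \<Rightarrow> 'a) \<Rightarrow> bool" where
  "refines_via \<mu> A \<alpha> B \<beta> \<pi> \<longleftrightarrow> \<pi> \<in> B \<rightarrow> A \<and> (AE x in \<mu>. \<pi> (\<beta> x) = \<alpha> x)"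

definition obs_itinerary ::
  "('g, 'm) monoid_scheme \<Rightarrow> ('g \<Rightarrow> 'x \<Rightarrow> 'x) \<Rightarrow> 'g set \<Rightarrow> ('x \<Rightarrow> 'b) \<Rightarrow> 'x \<Rightarrow> 'g \<Rightarrow> 'b" where
  "obs_itinerary G act F \<beta> x = (\<lambda>g\<in>F. \<beta> (act (inv\<^bsub>G\<^esub> g) x))"

text \<open>\<open>inv_into UNIV (\<sigma> g)\<close> is the inverse permutation (the notation \<open>inv\<close> is also used
  by HOL-Algebra).\<close>

definition AP ::
  "('g, 'm) monoid_scheme \<Rightarrow> ('g \<Rightarrow> 'x \<Rightarrow> 'x) \<Rightarrow> 'x measure \<Rightarrow> 'b set \<Rightarrow> ('x \<Rightarrow> 'b) \<Rightarrow> 'g set \<Rightarrow> real \<Rightarrow>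
   nat \<Rightarrow> ('g \<Rightarrow> nat \<Rightarrow> nat) \<Rightarrow> (nat \<Rightarrow> 'g \<Rightarrow> 'b) set" where
  "AP G act \<mu> B \<beta> F \<delta> d \<sigma> =
     {\<phi> \<in> {1..d} \<rightarrow>\<^sub>E (F \<rightarrow>\<^sub>E B).
        (\<Sum>b\<in>F \<rightarrow>\<^sub>E B. \<bar>measure_pmf.prob (unif d) (\<phi> -` {b})
                     - measure \<mu> (obs_itinerary G act F \<beta> -` {b} \<inter> space \<mu>)\<bar>) < \<delta> \<and>
        (\<forall>g\<in>F. measure_pmf.prob (unif d)
                  {j. \<phi> j g \<noteq> \<phi> (inv_into UNIV (\<sigma> g) j) \<one>\<^bsub>G\<^esub>} < \<delta>)}"

definition h_obs_loc ::
  "('g, 'm) monoid_scheme \<Rightarrow> (nat \<Rightarrow> nat) \<Rightarrow> (nat \<Rightarrow> 'g \<Rightarrow> nat \<Rightarrow> nat) \<Rightarrow> ('g \<Rightarrow> 'x \<Rightarrow> 'x) \<Rightarrow>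
   'x measure \<Rightarrow> ('b \<Rightarrow> 'a) \<Rightarrow> 'b set \<Rightarrow> ('x \<Rightarrow> 'b) \<Rightarrow> 'g set \<Rightarrow> real \<Rightarrow> ereal" where
  "h_obs_loc G d \<sigma> act \<mu> \<pi> B \<beta> F \<delta> =
     limsup (\<lambda>i. ereal (1 / real (d i)) *
       log_card (enat (card
         ((\<lambda>\<phi>. \<lambda>j\<in>{1..d i}. \<pi> (\<phi> j \<one>\<^bsub>G\<^esub>)) ` AP G act \<mu> B \<beta> F \<delta> (d i) (\<sigma> i)))))"

text \<open>The entropy of \<open>\<alpha>\<close> relative to a refinement \<open>\<beta>\<close>; \<open>\<alpha>\<close> enters only through \<open>\<pi>\<close>.\<close>

definition h_obs ::
  "('g, 'm) monoid_scheme \<Rightarrow> (nat \<Rightarrow> nat) \<Rightarrow> (nat \<Rightarrow> 'g \<Rightarrow> nat \<Rightarrow> nat) \<Rightarrow> ('g \<Rightarrow> 'x \<Rightarrow> 'x) \<Rightarrow>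
   'x measure \<Rightarrow> ('b \<Rightarrow> 'a) \<Rightarrow> 'b set \<Rightarrow> ('x \<Rightarrow> 'b) \<Rightarrow> ereal" where
  "h_obs G d \<sigma> act \<mu> \<pi> B \<beta> =
     (INF F \<in> {F. finite F \<and> F \<subseteq> carrier G \<and> \<one>\<^bsub>G\<^esub> \<in> F}. INF \<delta> \<in> {0<..}.
        h_obs_loc G d \<sigma> act \<mu> \<pi> B \<beta> F \<delta>)"

text \<open>Label sets range over the finite sets of natural numbers. Every finite label set is in
  bijection with one of these, and the quantities above are invariant under relabelling.\<close>

definition sofic_measure_entropy ::
  "('g, 'm) monoid_scheme \<Rightarrow> (nat \<Rightarrow> nat) \<Rightarrow> (nat \<Rightarrow> 'g \<Rightarrow> nat \<Rightarrow> nat) \<Rightarrow> ('g \<Rightarrow> 'x \<Rightarrow> 'x) \<Rightarrow>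
   'x measure \<Rightarrow> ereal" where
  "sofic_measure_entropy G d \<sigma> act \<mu> =
     (SUP (A, \<alpha>) \<in> {(A :: nat set, \<alpha>). observable \<mu> A \<alpha>}.
        INF (B, \<beta>, \<pi>) \<in> {(B :: nat set, \<beta>, \<pi>). observable \<mu> B \<beta> \<and> refines_via \<mu> A \<alpha> B \<beta> \<pi>}.
          h_obs G d \<sigma> act \<mu> \<pi> B \<beta>)"

end

theory Submission
  imports Defs
begin

text \<open>
  Both inequalities convert microstates into one another by means of compact sets.
  By inner regularity the cells of a finite observable contain, up to small measure, disjoint
  compact cores, and finitely many translates of \<open>\<Delta>\<close> keep these cores a positive distance apart.

  From \<open>\<Delta>\<close> to observables: given \<open>\<epsilon>\<close>, let \<open>\<alpha>\<close> be the index of a small \<open>\<Delta>\<close>-ball containing the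
  point. For every \<open>\<beta>\<close> refining \<open>\<alpha>\<close>, a model \<open>\<phi>\<close> is read as a microstate by labelling
  \<open>\<phi> (\<sigma>(g)\<^sup>-\<^sup>1 j)\<close> with the core of \<open>\<beta>\<close> next to it; Urysohn functions of the cores of the itinerary
  cells control the pattern frequencies. Equal \<open>\<alpha>\<close>-words force \<open>\<Delta>\<^sub>2\<close>-distance at most \<open>\<epsilon>\<close>.

  From observables to \<open>\<Delta>\<close>: given \<open>\<alpha>\<close>, choose \<open>\<epsilon>\<close> small against the separation of its cores. For all
  \<open>F, \<delta>, L\<close> there is a fine \<open>\<beta>\<close> refining \<open>\<alpha>\<close> such that replacing each label by a point of its cell
  turns microstates into models. Models at \<open>\<Delta>\<^sub>2\<close>-distance at most \<open>\<epsilon>\<close> come from \<open>\<alpha>\<close>-words that are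
  close in the Hamming distance, and Hamming balls contribute an arbitrarily small exponential rate.
\<close>

section \<open>Empirical frequencies\<close>

abbreviation freq :: "nat \<Rightarrow> nat set \<Rightarrow> real" where
  "freq d S \<equiv> measure_pmf.prob (unif d) S"

lemma set_pmf_unif: "0 < d \<Longrightarrow> set_pmf (unif d) = {1..d}"
  unfolding unif_def by (subst set_pmf_of_set) auto

lemma freq_eq_card: "0 < d \<Longrightarrow> freq d S = real (card ({1..d} \<inter> S)) / real d"
  unfolding unif_def by (subst measure_pmf_of_set) auto

lemma expectation_unif:
  fixes f :: "nat \<Rightarrow> real"
  shows "0 < d \<Longrightarrow> measure_pmf.expectation (unif d) f = (\<Sum>j=1..d. f j) / real d"
  unfolding unif_def by (subst integral_pmf_of_set) auto

text \<open>The uniform measure charges only \<open>{1..d}\<close>, so inclusions need checking only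
  there; microstates and models are specified on these indices alone.\<close>

lemma freq_mono:
  assumes "0 < d" and "\<And>j. j \<in> {1..d} \<Longrightarrow> j \<in> S \<Longrightarrow> j \<in> T"
  shows "freq d S \<le> freq d T"
proof -
  have "card ({1..d} \<inter> S) \<le> card ({1..d} \<inter> T)"
    using assms(2) by (intro card_mono) auto
  then show ?thesis
    by (simp add: freq_eq_card[OF assms(1)] divide_right_mono)
qed

lemma freq_cong:
  assumes "0 < d" and "\<And>j. j \<in> {1..d} \<Longrightarrow> j \<in> S \<longleftrightarrow> j \<in> T"
  shows "freq d S = freq d T"
  using freq_mono[OF assms(1)] assms(2) by (intro antisym) blast+

lemma freq_compl: "freq d (- S) = 1 - freq d S"
  using measure_pmf.prob_compl[of S "unif d"] by (simp add: Compl_eq_Diff_UNIV)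

lemma freq_Un_le: "freq d (S \<union> T) \<le> freq d S + freq d T"
  by (rule measure_subadditive) (auto simp: measure_pmf.emeasure_eq_measure)

lemma freq_UN_le: "finite I \<Longrightarrow> freq d (\<Union>i\<in>I. S i) \<le> (\<Sum>i\<in>I. freq d (S i))"
  by (rule measure_subadditive_finite) (auto simp: measure_pmf.emeasure_eq_measure)

text \<open>A permutation preserves the uniform measure, so exceptional sets of indices can be moved
  along \<open>\<sigma> i g\<close> or its inverse without changing their frequency.\<close>

lemma freq_permutes:
  assumes "0 < d" and "p permutes {1..d}"
  shows "freq d {j. P (p j)} = freq d {j. P j}"
proof -
  have "map_pmf p (unif d) = unif d"
    unfolding unif_def using assms
    by (intro map_pmf_of_set_bij_betw) (auto simp: permutes_imp_bij)
  then have "freq d {j. P j} = measure_pmf.prob (map_pmf p (unif d)) {j. P j}"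
    by simp
  also have "\<dots> = freq d {j. P (p j)}"
    by (simp add: vimage_def)
  finally show ?thesis ..
qed

lemma freq_sum_disjoint:
  assumes "finite I" and "disjoint_family_on S I"
  shows "(\<Sum>i\<in>I. freq d (S i)) = freq d (\<Union>i\<in>I. S i)"
  using assms by (intro measure_pmf.finite_measure_finite_Union[symmetric]) auto

section \<open>Quadratic mean distances versus frequencies of large distances\<close>

lemma Delta2_sq:
  assumes "0 < d"
  shows "(Delta2 \<Delta> d \<phi> \<psi>)\<^sup>2 = (\<Sum>j=1..d. (\<Delta> (\<phi> j) (\<psi> j))\<^sup>2) / real d"
  unfolding Delta2_def using assms by (simp add: sum_nonneg)

text \<open>Chebyshev's inequality: each index in the set contributes at least
  \<open>s\<^sup>2\<close> to the sum of squares.\<close>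

lemma freq_ge_le_Delta2:
  assumes d: "0 < d" and s: "0 < s" and le: "Delta2 \<Delta> d \<phi> \<psi> \<le> \<delta>"
  shows "freq d {j. s \<le> \<Delta> (\<phi> j) (\<psi> j)} \<le> \<delta>\<^sup>2 / s\<^sup>2"
proof -
  let ?S = "{1..d} \<inter> {j. s \<le> \<Delta> (\<phi> j) (\<psi> j)}"
  have "real (card ?S) * s\<^sup>2 = (\<Sum>j\<in>?S. s\<^sup>2)" by simp
  also have "\<dots> \<le> (\<Sum>j\<in>?S. (\<Delta> (\<phi> j) (\<psi> j))\<^sup>2)"
    using s by (intro sum_mono power_mono) auto
  also have "\<dots> \<le> (\<Sum>j=1..d. (\<Delta> (\<phi> j) (\<psi> j))\<^sup>2)"
    by (intro sum_mono2) auto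
  also have "\<dots> = (Delta2 \<Delta> d \<phi> \<psi>)\<^sup>2 * real d"
    using d by (simp add: Delta2_sq)
  also have "\<dots> \<le> \<delta>\<^sup>2 * real d"
    using le by (intro mult_right_mono power_mono) (auto simp: Delta2_def sum_nonneg)
  finally show ?thesis
    using d s by (simp add: freq_eq_card field_simps)
qed

text \<open>Converse to the Chebyshev bound: indices at distance at most \<open>s\<close> contribute
  \<open>s\<^sup>2\<close>, the others at most \<open>C\<^sup>2\<close>. This is where boundedness
  of the pseudometric enters.\<close>

lemma Delta2_le:
  assumes d: "0 < d" and s: "0 \<le> s" and nn: "\<And>x y. 0 \<le> \<Delta> x y" and C: "\<And>x y. \<Delta> x y \<le> C"
    and \<kappa>: "freq d {j. s < \<Delta> (\<phi> j) (\<psi> j)} \<le> \<kappa>"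
  shows "Delta2 \<Delta> d \<phi> \<psi> \<le> sqrt (s\<^sup>2 + C\<^sup>2 * \<kappa>)"
proof -
  let ?S = "{j. s < \<Delta> (\<phi> j) (\<psi> j)}"
  have "(\<Delta> (\<phi> j) (\<psi> j))\<^sup>2 \<le> s\<^sup>2 + C\<^sup>2 * indicator ?S j" for j
  proof (cases "j \<in> ?S")
    case True
    have "(\<Delta> (\<phi> j) (\<psi> j))\<^sup>2 \<le> C\<^sup>2" using nn C by (intro power_mono) auto
    then show ?thesis using True by (simp add: add_increasing)
  next
    case False
    then show ?thesis using nn by (auto intro: power_mono)
  qed
  then have "(\<Sum>j=1..d. (\<Delta> (\<phi> j) (\<psi> j))\<^sup>2) \<le> (\<Sum>j=1..d. s\<^sup>2 + C\<^sup>2 * indicator ?S j)"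
    by (intro sum_mono)
  also have "\<dots> = real d * s\<^sup>2 + C\<^sup>2 * real (card ({1..d} \<inter> ?S))"
    by (simp add: sum.distrib sum_distrib_left[symmetric] indicator_def if_distrib sum.If_cases)
  finally have "(Delta2 \<Delta> d \<phi> \<psi>)\<^sup>2 \<le> s\<^sup>2 + C\<^sup>2 * freq d ?S"
    using d by (simp add: Delta2_sq freq_eq_card field_simps)
  also have "\<dots> \<le> s\<^sup>2 + C\<^sup>2 * \<kappa>"
    using \<kappa> by (intro add_left_mono mult_left_mono) auto
  finally show ?thesis by (rule real_le_rsqrt)
qed

text \<open>If \<open>t \<ge> - \<zeta>\<close> then
  \<open>\<bar>t\<bar> \<le> t + 2 * \<zeta>\<close>; with equal totals the differences
  \<open>t\<close> sum to zero and only the error terms remain.\<close>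

lemma sum_abs_diff_le_of_one_sided:
  fixes p q :: "'a \<Rightarrow> real"
  assumes "sum p I = sum q I" and "\<And>c. c \<in> I \<Longrightarrow> q c \<le> p c + \<zeta>" and "0 \<le> \<zeta>"
  shows "(\<Sum>c\<in>I. \<bar>p c - q c\<bar>) \<le> 2 * real (card I) * \<zeta>"
proof -
  have "(\<Sum>c\<in>I. \<bar>p c - q c\<bar>) \<le> (\<Sum>c\<in>I. (p c - q c) + 2 * \<zeta>)"
    using assms(2,3) by (intro sum_mono) (smt (verit))
  also have "\<dots> = 2 * real (card I) * \<zeta>"
    using assms(1) by (simp add: sum.distrib sum_subtractf)
  finally show ?thesis .
qed

section \<open>Cardinalities\<close>

lemma log_card_enat: "log_card (enat k) = (if k = 0 then -\<infinity> else ereal (ln (real k)))"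
  by (simp add: log_card_def)

lemma log_card_mono: "m \<le> n \<Longrightarrow> log_card m \<le> log_card n"
  by (cases m; cases n) (auto simp: log_card_def)

lemma log_card_le_add:
  assumes "real k \<le> exp c * real n" and "enat n \<le> m"
  shows "log_card (enat k) \<le> ereal c + log_card m"
proof (cases "k = 0")
  case False
  then have k: "0 < real k" by simp
  with assms(1) have n: "0 < real n"
    by (metis exp_gt_zero less_le_trans zero_less_mult_pos)
  have "ln (real k) \<le> ln (exp c * real n)"
    using k n assms(1) by (subst ln_le_cancel_iff) auto
  also have "\<dots> = c + ln (real n)" using n by (simp add: ln_mult)
  finally have "log_card (enat k) \<le> ereal c + log_card (enat n)"
    using n False by (simp add: log_card_enat)
  also have "\<dots> \<le> ereal c + log_card m"
    using assms(2) by (intro add_left_mono log_card_mono)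
  finally show ?thesis .
qed (simp add: log_card_enat)

section \<open>Separated sets, nets and Hamming balls\<close>

lemma card_le_sep_number:
  assumes "finite N" "N \<subseteq> A" "\<And>x y. x \<in> N \<Longrightarrow> y \<in> N \<Longrightarrow> x \<noteq> y \<Longrightarrow> \<rho> x y > \<epsilon>"
  shows "enat (card N) \<le> sep_number \<epsilon> A \<rho>"
  unfolding sep_number_def using assms by (intro SUP_upper) auto

text \<open>Points with equal codes are too close to be separated, so the coding map is injective on
  every separated set.\<close>

lemma sep_number_le_card:
  assumes "finite T" and "f \<in> A \<rightarrow> T"
    and "\<And>x y. x \<in> A \<Longrightarrow> y \<in> A \<Longrightarrow> f x = f y \<Longrightarrow> \<rho> x y \<le> \<epsilon>"
  shows "sep_number \<epsilon> A \<rho> \<le> enat (card T)"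
  unfolding sep_number_def
proof (rule SUP_least)
  fix N assume "N \<in> {N. N \<subseteq> A \<and> finite N \<and> (\<forall>x\<in>N. \<forall>y\<in>N. x \<noteq> y \<longrightarrow> \<epsilon> < \<rho> x y)}"
  then have N: "N \<subseteq> A" "\<And>x y. x \<in> N \<Longrightarrow> y \<in> N \<Longrightarrow> x \<noteq> y \<Longrightarrow> \<epsilon> < \<rho> x y"
    by auto
  have "inj_on f N"
    using N assms(3) by (intro inj_onI) (meson leD subsetD)
  then have "card N \<le> card T"
    using N(1) assms(1,2) by (intro card_inj_on_le[of f]) auto
  then show "enat (card N) \<le> enat (card T)" by simp
qed

text \<open>A separated subset that is maximal under inclusion is a net: a point far from all its
  elements could be added. Below, \<open>\<rho>\<close> is a pseudometric pulled back to words, so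
  that \<open>V\<close> consists of words.\<close>

lemma maximal_separated_subset:
  assumes "finite W" and refl: "\<And>w. w \<in> W \<Longrightarrow> \<rho> w w \<le> (\<epsilon>::real)"
    and sym: "\<And>v w. \<rho> v w = \<rho> w v"
  obtains V where "V \<subseteq> W" "\<And>v w. v \<in> V \<Longrightarrow> w \<in> V \<Longrightarrow> v \<noteq> w \<Longrightarrow> \<epsilon> < \<rho> v w"
    "\<And>w. w \<in> W \<Longrightarrow> \<exists>v\<in>V. \<rho> v w \<le> \<epsilon>"
proof -
  let ?\<S> = "{V. V \<subseteq> W \<and> (\<forall>v\<in>V. \<forall>w\<in>V. v \<noteq> w \<longrightarrow> \<epsilon> < \<rho> v w)}"
  have "finite ?\<S>" using assms(1) by simp
  moreover have "{} \<in> ?\<S>" by simp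
  ultimately obtain V where V: "V \<in> ?\<S>" and max: "\<And>U. U \<in> ?\<S> \<Longrightarrow> V \<subseteq> U \<Longrightarrow> V = U"
    using finite_has_maximal[of ?\<S>] by (metis (no_types, lifting) empty_iff)
  show ?thesis
  proof (rule that)
    show "\<exists>v\<in>V. \<rho> v w \<le> \<epsilon>" if w: "w \<in> W" for w
    proof (rule ccontr)
      assume "\<not> ?thesis"
      then have far: "\<forall>v\<in>V. \<epsilon> < \<rho> v w" by auto
      then have "insert w V \<in> ?\<S>" using V w sym by auto
      with max have "w \<in> V" by blast
      with far refl[OF w] show False by auto
    qed
  qed (use V in auto)
qed

text \<open>Chernoff-type estimate: give each word the weight \<open>t\<close> to the power of its Hamming distance
  to \<open>w0\<close>, for small \<open>t\<close>. Unlike an asymptotic estimate this holds for every length \<open>d\<close>,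
  so that \<open>d\<close> need not tend to infinity.\<close>

lemma card_Hamming_ball:
  fixes A :: "'a set"
  assumes A: "finite A" and \<eta>: "0 < \<eta>"
  obtains \<kappa> where "0 < \<kappa>"
    "\<And>d w0. 0 < d \<Longrightarrow> real (card {w \<in> {1..d} \<rightarrow>\<^sub>E A. freq d {j. w j \<noteq> w0 j} \<le> \<kappa>}) \<le> exp (\<eta> * real d)"
proof -
  \<comment> \<open>The choice gives \<open>1 + t * card A \<le> exp (\<eta> / 2)\<close>, the bound
    for the total weight of one coordinate.\<close>
  define t where "t = min (1/2) (\<eta> / (2 * (real (card A) + 1)))"
  have t: "0 < t" "t < 1" using \<eta> by (auto simp: t_def add_nonneg_pos)
  have "t * real (card A) \<le> \<eta> / (2 * (real (card A) + 1)) * (real (card A) + 1)"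
    using \<eta> by (intro mult_mono) (auto simp: t_def)
  also have "\<dots> = \<eta> / 2"
    by (simp add: field_simps)
  finally have tA: "t * real (card A) \<le> \<eta> / 2" .
  have lt: "0 < - ln t" using t by simp
  \<comment> \<open>With this radius a word in the ball differs in at most
    \<open>\<kappa> * d\<close> places, so its weight is at least
    \<open>exp (- \<eta> * d / 2)\<close>.\<close>
  define \<kappa> where "\<kappa> = \<eta> / (2 * (- ln t))"
  have \<kappa>: "0 < \<kappa>" unfolding \<kappa>_def using \<eta> lt by (intro divide_pos_pos) auto
  show ?thesis
  proof (rule that[OF \<kappa>])
    fix d :: nat and w0 :: "nat \<Rightarrow> 'a"
    assume d: "0 < d"
    let ?H = "\<lambda>w. {1..d} \<inter> {j. w j \<noteq> w0 j}"
    let ?B = "{w \<in> {1..d} \<rightarrow>\<^sub>E A. freq d {j. w j \<noteq> w0 j} \<le> \<kappa>}"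
    have wt: "(\<Prod>j=1..d. if w j = w0 j then 1 else t) = t ^ card (?H w)" for w
      by (subst prod.If_cases) (auto simp: Collect_neg_eq)
    have low: "exp (- (\<eta> * real d / 2)) \<le> t ^ card (?H w)" if "w \<in> ?B" for w
    proof -
      have "real (card (?H w)) \<le> \<kappa> * real d"
        using that d by (simp add: freq_eq_card field_simps)
      then have "real (card (?H w)) * (- ln t) \<le> \<kappa> * real d * (- ln t)"
        using lt by (intro mult_right_mono) auto
      also have "\<dots> = \<eta> * real d / 2" using lt by (simp add: \<kappa>_def field_simps)
      finally have "- (\<eta> * real d / 2) \<le> real (card (?H w)) * ln t" by simp
      then have "exp (- (\<eta> * real d / 2)) \<le> exp (real (card (?H w)) * ln t)" by simp
      also have "\<dots> = t ^ card (?H w)" using t by (simp add: exp_of_nat_mult)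
      finally show ?thesis .
    qed
    have fin: "finite ({1..d} \<rightarrow>\<^sub>E A)" using A by (intro finite_PiE) auto
    have "real (card ?B) * exp (- (\<eta> * real d / 2)) = (\<Sum>w\<in>?B. exp (- (\<eta> * real d / 2)))" by simp
    also have "\<dots> \<le> (\<Sum>w\<in>?B. t ^ card (?H w))" using low by (intro sum_mono) auto
    also have "\<dots> \<le> (\<Sum>w\<in>{1..d} \<rightarrow>\<^sub>E A. t ^ card (?H w))"
      using fin t by (intro sum_mono2) auto
    \<comment> \<open>The weight is a product over coordinates, so its sum over all words is a
      product of sums over letters.\<close>
    also have "\<dots> = (\<Prod>j=1..d. \<Sum>a\<in>A. if a = w0 j then 1 else t)"
      using A by (subst prod_sum_PiE) (simp_all only: wt finite_atLeastAtMost)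
    also have "\<dots> \<le> (\<Prod>j=1..d. exp (\<eta> / 2))"
    proof (intro prod_mono conjI)
      fix j assume "j \<in> {1..d}"
      show "0 \<le> (\<Sum>a\<in>A. if a = w0 j then 1 else t)" using t by (intro sum_nonneg) auto
      have "(\<Sum>a\<in>A. if a = w0 j then 1 else t) \<le> (\<Sum>a\<in>A. (if a = w0 j then 1 else 0) + t)"
        using t by (intro sum_mono) auto
      also have "\<dots> \<le> 1 + t * real (card A)"
        using A by (simp add: sum.distrib mult.commute)
      also have "\<dots> \<le> exp (\<eta> / 2)" using exp_ge_add_one_self[of "\<eta> / 2"] tA by linarith
      finally show "(\<Sum>a\<in>A. if a = w0 j then 1 else t) \<le> exp (\<eta> / 2)" .
    qed
    also have "\<dots> = exp (\<eta> * real d / 2)" by (simp add: exp_of_nat_mult[symmetric] mult.commute)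
    finally have "real (card ?B) * exp (- (\<eta> * real d / 2)) * exp (\<eta> * real d / 2)
        \<le> exp (\<eta> * real d / 2) * exp (\<eta> * real d / 2)"
      by (intro mult_right_mono) auto
    then show "real (card ?B) \<le> exp (\<eta> * real d)"
      by (simp add: mult.assoc exp_add[symmetric])
  qed
qed

section \<open>Integrals and continuous functions\<close>

text \<open>Stated for any probability space because it is applied twice: to itineraries under \<mu>
  and to a microstate under the uniform measure. The two integrals become sums over the same
  patterns with different weights.\<close>

lemma (in prob_space) expectation_finite_range:
  fixes h :: "'b \<Rightarrow> real"
  assumes I: "finite I" and AE_I: "AE y in M. T y \<in> I"
    and meas: "\<And>c. c \<in> I \<Longrightarrow> T -` {c} \<inter> space M \<in> sets M"
    and h: "(\<lambda>y. h (T y)) \<in> borel_measurable M"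
  shows "expectation (\<lambda>y. h (T y)) = (\<Sum>c\<in>I. prob (T -` {c} \<inter> space M) * h c)"
proof -
  let ?S = "\<lambda>c. T -` {c} \<inter> space M"
  have "expectation (\<lambda>y. h (T y)) = expectation (\<lambda>y. \<Sum>c\<in>I. indicator (?S c) y * h c)"
  proof (rule integral_cong_AE)
    show "AE y in M. h (T y) = (\<Sum>c\<in>I. indicator (?S c) y * h c)"
      using AE_I AE_space
    proof eventually_elim
      case (elim y)
      then have "(\<Sum>c\<in>I. indicator (?S c) y * h c) = (\<Sum>c\<in>I. if c = T y then h c else 0)"
        by (intro sum.cong) auto
      then show ?case using elim I by simp
    qed
  qed (use h meas in auto)
  also have "\<dots> = (\<Sum>c\<in>I. expectation (\<lambda>y. indicator (?S c) y * h c))"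
    using meas by (intro Bochner_Integration.integral_sum integrable_mult_left)
      (auto simp: integrable_indicator_iff emeasure_eq_measure)
  also have "\<dots> = (\<Sum>c\<in>I. prob (?S c) * h c)"
    using meas by (intro sum.cong) auto
  finally show ?thesis .
qed

text \<open>Metrizable spaces are normal, so Urysohn's lemma applies; the range in the unit interval
  makes the function bounded. These are the test functions for weak closeness.\<close>

lemma urysohn_function:
  fixes C V :: "'a :: metric_space set"
  assumes "closed C" "open V" "C \<subseteq> V"
  shows "\<exists>h :: 'a \<Rightarrow>\<^sub>C real. (\<forall>x. 0 \<le> h x \<and> h x \<le> 1) \<and> (\<forall>x\<in>C. h x = 1) \<and> (\<forall>x. x \<notin> V \<longrightarrow> h x = 0)"
proof -
  have "normal_space (euclidean :: 'a topology)"
    by (intro metrizable_imp_normal_space metrizable_space_euclidean)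
  then obtain f :: "'a \<Rightarrow> real" where f: "continuous_map euclidean (top_of_set {0..1}) f"
      "f ` (- V) \<subseteq> {0}" "f ` C \<subseteq> {1}"
    using Urysohn_lemma[of euclidean "- V" C 0 1] assms
    by (auto simp: disjnt_def simp flip: closed_closedin)
  have cont: "continuous_on UNIV f" and range: "\<And>x. f x \<in> {0..1}"
    using f(1) by (auto simp: continuous_map_in_subtopology)
  have "f \<in> bcontfun"
    using range by (intro bcontfun_normI[OF cont, of 1]) (simp add: abs_le_iff)
  then have "apply_bcontfun (Bcontfun f) = f" by (rule Bcontfun_inverse)
  then show ?thesis
    using range f(2,3) by (intro exI[of _ "Bcontfun f"]) auto
qed

section \<open>The dynamical setting\<close>

locale entropy_setting = group G
  for G :: "('g, 'm) monoid_scheme" (structure) +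
  fixes d :: "nat \<Rightarrow> nat"
    and \<sigma> :: "nat \<Rightarrow> 'g \<Rightarrow> nat \<Rightarrow> nat"
    and act :: "'g \<Rightarrow> 'x::polish_space \<Rightarrow> 'x"
    and \<mu> :: "'x measure"
    and \<Delta> :: "'x \<Rightarrow> 'x \<Rightarrow> real"
  assumes sofic: "sofic_approximation G d \<sigma>"
    and action: "continuous_action G act"
    and inv_prob: "invariant_prob G act \<mu>"
    and dyn_gen: "dynamically_generating G act \<Delta>"
begin

section \<open>Basic properties of the action, the measure, the pseudometric and the
  approximation\<close>

sublocale prob_space \<mu>
  using inv_prob by (simp add: invariant_prob_def)

lemma sets_\<mu> [measurable_cong, simp]: "sets \<mu> = sets borel"
  using inv_prob by (simp add: invariant_prob_def)

lemma space_\<mu> [simp]: "space \<mu> = UNIV"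
  using sets_eq_imp_space_eq[OF sets_\<mu>] by simp

lemma act_one [simp]: "act \<one> x = x"
proof -
  interpret group_action G UNIV act using action by (simp add: continuous_action_def)
  show ?thesis using fun_cong[OF id_eq_one, of x] by simp
qed

lemma act_mult: "g \<in> carrier G \<Longrightarrow> h \<in> carrier G \<Longrightarrow> act (g \<otimes> h) x = act g (act h x)"
proof -
  interpret group_action G UNIV act using action by (simp add: continuous_action_def)
  show "g \<in> carrier G \<Longrightarrow> h \<in> carrier G \<Longrightarrow> ?thesis" by (simp add: composition_rule)
qed

lemma act_inv: "g \<in> carrier G \<Longrightarrow> act g (act (inv g) x) = x"
  by (simp flip: act_mult)

lemma continuous_act: "g \<in> carrier G \<Longrightarrow> continuous_on S (act g)"
  using action unfolding continuous_action_def homeomorphism_def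
  by (meson continuous_on_subset subset_UNIV)

lemma measurable_act [measurable]: "g \<in> carrier G \<Longrightarrow> act g \<in> \<mu> \<rightarrow>\<^sub>M borel"
  using borel_measurable_continuous_onI[OF continuous_act] by simp

lemma prob_act:
  assumes "g \<in> carrier G" "S \<in> sets borel"
  shows "prob {x. act g x \<in> S} = prob S"
proof -
  have "prob S = measure (distr \<mu> borel (act g)) S"
    using inv_prob assms(1) by (simp add: invariant_prob_def)
  also have "\<dots> = prob {x. act g x \<in> S}"
    using assms by (subst measure_distr) (auto simp: vimage_def)
  finally show ?thesis ..
qed

lemma \<Delta>_nonneg: "0 \<le> \<Delta> x y" and \<Delta>_refl [simp]: "\<Delta> x x = 0" and \<Delta>_sym: "\<Delta> x y = \<Delta> y x"
  and \<Delta>_tri: "\<Delta> x z \<le> \<Delta> x y + \<Delta> y z" and continuous_\<Delta>: "continuous_on UNIV (\<lambda>(x, y). \<Delta> x y)"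
  using dyn_gen by (auto simp: dynamically_generating_def bounded_continuous_pseudometric_def)

lemma \<Delta>_bound: obtains C where "0 < C" "\<And>x y. \<Delta> x y \<le> C"
proof -
  obtain C where "\<And>x y. \<Delta> x y \<le> C"
    using dyn_gen by (auto simp: dynamically_generating_def bounded_continuous_pseudometric_def)
  then have "\<And>x y. \<Delta> x y \<le> max C 1" by (simp add: max.coboundedI1)
  then show ?thesis by (intro that[of "max C 1"]) auto
qed

lemma continuous_\<Delta>_comp:
  assumes "continuous_on S f" "continuous_on S g"
  shows "continuous_on S (\<lambda>z. \<Delta> (f z) (g z))"
  using continuous_on_compose2[OF continuous_\<Delta>, of S "\<lambda>z. (f z, g z)"] assms
  by (auto intro: continuous_on_Pair)

lemma Delta2_sym: "Delta2 \<Delta> n \<phi> \<psi> = Delta2 \<Delta> n \<psi> \<phi>"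
  by (simp add: Delta2_def \<Delta>_sym)

lemma Delta2_refl: "Delta2 \<Delta> n \<phi> \<phi> = 0"
  by (simp add: Delta2_def)

lemma d_pos: "0 < d i"
  using sofic by (simp add: sofic_approximation_def)

lemma permutes_\<sigma>: "g \<in> carrier G \<Longrightarrow> \<sigma> i g permutes {1..d i}"
  using sofic by (simp add: sofic_approximation_def)

text \<open>The relation of lying in a common Bowen ball: the dynamical ball of radius
  \<open>r\<close> along the time set \<open>F\<close>. As a relation it lets radii be added by
  \<open>near_tri\<close>.\<close>

definition near :: "'g set \<Rightarrow> real \<Rightarrow> 'x \<Rightarrow> 'x \<Rightarrow> bool" where
  "near F r x y \<longleftrightarrow> (\<forall>f\<in>F. \<Delta> (act f x) (act f y) < r)"

lemma near_sym: "near F r x y \<longleftrightarrow> near F r y x"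
  by (simp add: near_def \<Delta>_sym)

lemma near_tri: "near F r x y \<Longrightarrow> near F s y z \<Longrightarrow> near F (r + s) x z"
  unfolding near_def by (meson \<Delta>_tri add_strict_mono le_less_trans)

lemma near_mono: "near F r x y \<Longrightarrow> r \<le> s \<Longrightarrow> near F s x y"
  unfolding near_def by (meson less_le_trans)

lemma open_near:
  assumes "finite F" "F \<subseteq> carrier G"
  shows "open {x. near F r x y}"
proof -
  have "open {x. \<Delta> (act f x) (act f y) < r}" if "f \<in> F" for f
    using that assms(2)
    by (intro open_Collect_less continuous_\<Delta>_comp continuous_act continuous_on_const) auto
  then have "open (\<Inter>f\<in>F. {x. \<Delta> (act f x) (act f y) < r})"
    using assms(1) by (intro open_INT) auto
  also have "(\<Inter>f\<in>F. {x. \<Delta> (act f x) (act f y) < r}) = {x. near F r x y}"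
    by (auto simp: near_def)
  finally show ?thesis .
qed

section \<open>Dynamical separation of compact sets and finite approximations of the space\<close>

text \<open>As \<open>\<Delta>\<close> is dynamically generating, its translates separate points.\<close>

lemma compact_separation:
  assumes K: "compact K" "compact K'" and disj: "K \<inter> K' = {}"
  obtains F c where "finite F" "F \<subseteq> carrier G" "0 < c"
    "\<And>x y. x \<in> K \<Longrightarrow> y \<in> K' \<Longrightarrow> \<exists>g\<in>F. c \<le> \<Delta> (act g x) (act g y)"
proof -
  \<comment> \<open>The thresholds are discrete, so a finite subcover of
    \<open>K \<times> K'\<close> supplies finitely many group elements together with a positive
    least threshold.\<close>
  define U where "U = (\<lambda>(g, n::nat). {p. inverse (real (Suc n)) < \<Delta> (act g (fst p)) (act g (snd p))})"
  have "open (U t)" if t_in: "t \<in> carrier G \<times> UNIV" for t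
  proof -
    obtain g n where t: "t = (g, n)" and g: "g \<in> carrier G" using t_in by auto
    have *: "continuous_on UNIV (\<lambda>p. act g (fst p))" "continuous_on UNIV (\<lambda>p. act g (snd p))"
      by (rule continuous_on_compose2[OF continuous_act[OF g, of UNIV]];
          auto intro: continuous_intros)+
    show ?thesis unfolding U_def t prod.case
      by (intro open_Collect_less continuous_\<Delta>_comp * continuous_on_const)
  qed
  moreover have "K \<times> K' \<subseteq> (\<Union>t\<in>carrier G \<times> UNIV. U t)"
  proof safe
    fix x y assume "x \<in> K" "y \<in> K'"
    \<comment> \<open>The generating property is used at \<open>x\<close> for the complement of
      \<open>y\<close>: since \<open>y\<close> is outside this set, some \<open>g\<close> in
      \<open>F\<close> must move the pair to distance at least \<delta>.\<close>
    then have "open (- {y})" "x \<in> - {y}" using disj by auto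
    then obtain \<delta> F where \<delta>: "\<delta> > 0" "F \<subseteq> carrier G"
      and F: "\<And>z. (\<forall>g\<in>F. \<Delta> (act g x) (act g z) < \<delta>) \<Longrightarrow> z \<in> - {y}"
      using dyn_gen unfolding dynamically_generating_def by metis
    from F[of y] obtain g where g: "g \<in> F" "\<Delta> (act g x) (act g y) \<ge> \<delta>"
      by force
    obtain n where "inverse (real (Suc n)) < \<delta>" using reals_Archimedean[OF \<open>\<delta> > 0\<close>] by auto
    with g \<delta> show "(x, y) \<in> (\<Union>t\<in>carrier G \<times> UNIV. U t)"
      by (intro UN_I[of "(g, n)"]) (auto simp: U_def)
  qed
  moreover have "compact (K \<times> K')" using K by (rule compact_Times)
  ultimately obtain T where T: "T \<subseteq> carrier G \<times> UNIV" "finite T" "K \<times> K' \<subseteq> (\<Union>t\<in>T. U t)"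
    by (metis compactE_image)
  \<comment> \<open>The inserted 1 keeps the minimum meaningful when the subcover is empty, which
    can happen if one of the compact sets is empty.\<close>
  define c where "c = Min (insert 1 ((\<lambda>t. inverse (real (Suc (snd t)))) ` T))"
  show ?thesis
  proof (rule that)
    show "finite (fst ` T)" "fst ` T \<subseteq> carrier G" using T by auto
    show "0 < c" unfolding c_def using T by (subst Min_gr_iff) auto
    fix x y assume "x \<in> K" "y \<in> K'"
    then obtain g n where gn: "(g, n) \<in> T" "inverse (real (Suc n)) < \<Delta> (act g x) (act g y)"
      using T(3) by (fastforce simp: U_def)
    have "c \<le> inverse (real (Suc n))"
      unfolding c_def using T gn by (intro Min_le) (auto intro!: image_eqI[of _ _ "(g, n)"])
    then show "\<exists>g\<in>fst ` T. c \<le> \<Delta> (act g x) (act g y)"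
      using gn by (intro bexI[of _ g]) (auto intro!: image_eqI[of _ _ "(g, n)"])
  qed
qed

text \<open>Inner regularity of finite Borel measures on Polish spaces, with an additive error. A
  set of measure at most \<kappa> is served by the empty core; otherwise
  \<open>prob E - \<kappa>\<close> is positive and compares correctly in
  \<open>ennreal\<close>.\<close>

lemma compact_core:
  assumes "E \<in> sets borel" "0 < \<kappa>"
  obtains K where "compact K" "K \<subseteq> E" "prob E \<le> prob K + \<kappa>"
proof -
  have eq: "emeasure \<mu> E = (SUP K \<in> {K. K \<subseteq> E \<and> compact K}. emeasure \<mu> K)"
    using assms by (intro inner_regular) auto
  show ?thesis
  proof (cases "prob E \<le> \<kappa>")
    case True
    then show ?thesis by (intro that[of "{}"]) auto
  next
    case False
    then have "ennreal (prob E - \<kappa>) < emeasure \<mu> E"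
      using assms(2) by (simp add: emeasure_eq_measure ennreal_less_iff)
    then obtain K where "K \<subseteq> E" "compact K" "ennreal (prob E - \<kappa>) < emeasure \<mu> K"
      unfolding eq less_SUP_iff by auto
    then show ?thesis
      using False by (intro that[of K]) (auto simp: emeasure_eq_measure ennreal_less_iff)
  qed
qed

text \<open>Disjoint cells have disjoint compact cores. There are finitely many pairs of them, so
  the finite sets of separating group elements can be united and the least separation constant taken
  as radius.\<close>

lemma separated_cores:
  assumes I: "finite I" and E: "\<And>i. i \<in> I \<Longrightarrow> E i \<in> sets borel" "disjoint_family_on E I"
    and \<kappa>: "0 < \<kappa>"
  obtains K F r where "\<And>i. i \<in> I \<Longrightarrow> compact (K i)" "\<And>i. i \<in> I \<Longrightarrow> K i \<subseteq> E i"
    "\<And>i. i \<in> I \<Longrightarrow> prob (E i) \<le> prob (K i) + \<kappa>" "finite F" "F \<subseteq> carrier G" "\<one> \<in> F" "0 < r"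
    "\<And>i j x y. i \<in> I \<Longrightarrow> j \<in> I \<Longrightarrow> i \<noteq> j \<Longrightarrow> x \<in> K i \<Longrightarrow> y \<in> K j \<Longrightarrow> \<not> near F r x y"
proof -
  have "\<forall>i\<in>I. \<exists>K. compact K \<and> K \<subseteq> E i \<and> prob (E i) \<le> prob K + \<kappa>"
    by (meson compact_core E(1) \<kappa>)
  from bchoice[OF this] obtain K where "\<forall>i\<in>I. compact (K i) \<and> K i \<subseteq> E i \<and> prob (E i) \<le> prob (K i) + \<kappa>"
    by blast
  then have K: "\<And>i. i \<in> I \<Longrightarrow> compact (K i)" "\<And>i. i \<in> I \<Longrightarrow> K i \<subseteq> E i"
    "\<And>i. i \<in> I \<Longrightarrow> prob (E i) \<le> prob (K i) + \<kappa>"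
    by blast+
  define J where "J = {(i, j). i \<in> I \<and> j \<in> I \<and> i \<noteq> j}"
  have J: "finite J" by (rule finite_subset[of _ "I \<times> I"]) (use I in \<open>auto simp: J_def\<close>)
  have ex: "\<forall>t\<in>J. \<exists>Fc. finite (fst Fc) \<and> (fst Fc) \<subseteq> carrier G \<and> 0 < (snd Fc) \<and>
      (\<forall>x\<in>K (fst t). \<forall>y\<in>K (snd t). \<exists>g\<in>(fst Fc). (snd Fc) \<le> \<Delta> (act g x) (act g y))"
  proof
    fix t assume t: "t \<in> J"
    have "compact (K (fst t))" "compact (K (snd t))" "K (fst t) \<inter> K (snd t) = {}"
      using K(1,2) E(2) t by (fastforce simp: J_def disjoint_family_on_def)+
    then obtain F c where "finite F" "F \<subseteq> carrier G" "0 < c"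
      "\<And>x y. x \<in> K (fst t) \<Longrightarrow> y \<in> K (snd t) \<Longrightarrow> \<exists>g\<in>F. c \<le> \<Delta> (act g x) (act g y)"
      using compact_separation[of "K (fst t)" "K (snd t)"] by blast
    then show "\<exists>Fc. finite (fst Fc) \<and> (fst Fc) \<subseteq> carrier G \<and> 0 < (snd Fc) \<and>
      (\<forall>x\<in>K (fst t). \<forall>y\<in>K (snd t). \<exists>g\<in>(fst Fc). (snd Fc) \<le> \<Delta> (act g x) (act g y))"
      by (intro exI[of _ "(F, c)"]) auto
  qed
  obtain Fc where Fc': "\<forall>t\<in>J. finite (fst (Fc t)) \<and> (fst (Fc t)) \<subseteq> carrier G \<and> 0 < (snd (Fc t)) \<and>
      (\<forall>x\<in>K (fst t). \<forall>y\<in>K (snd t). \<exists>g\<in>(fst (Fc t)). (snd (Fc t)) \<le> \<Delta> (act g x) (act g y))"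
    using bchoice[OF ex] by (rule exE)
  define F c where "F = fst \<circ> Fc" and "c = snd \<circ> Fc"
  have Fc: "\<And>t. t \<in> J \<Longrightarrow> finite (F t)" "\<And>t. t \<in> J \<Longrightarrow> F t \<subseteq> carrier G"
    "\<And>t. t \<in> J \<Longrightarrow> 0 < (c t :: real)"
    "\<And>t x y. t \<in> J \<Longrightarrow> x \<in> K (fst t) \<Longrightarrow> y \<in> K (snd t) \<Longrightarrow> \<exists>g\<in>F t. c t \<le> \<Delta> (act g x) (act g y)"
    using Fc' by (auto simp: F_def c_def)
  define r where "r = Min (insert 1 (c ` J))"
  show ?thesis
  proof (rule that[OF K])
    \<comment> \<open>Adjoining the identity makes \<open>near\<close> bound \<Delta> itself, not
      only its translates.\<close>
    show "finite (insert \<one> (\<Union>t\<in>J. F t))" using J Fc(1) by blast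
    show "insert \<one> (\<Union>t\<in>J. F t) \<subseteq> carrier G" using Fc(2) by blast
    show "0 < r" unfolding r_def using J Fc by (subst Min_gr_iff) auto
    fix i j x y assume *: "i \<in> I" "j \<in> I" "i \<noteq> j" "x \<in> K i" "y \<in> K j"
    then have ij: "(i, j) \<in> J" by (simp add: J_def)
    then obtain g where g: "g \<in> F (i, j)" "c (i, j) \<le> \<Delta> (act g x) (act g y)"
      using Fc(4)[of "(i, j)"] * by auto
    have "r \<le> c (i, j)" unfolding r_def using J ij by (intro Min_le) auto
    then show "\<not> near (insert \<one> (\<Union>t\<in>J. F t)) r x y"
      using g ij unfolding near_def by (meson UN_I insertI2 le_less_trans not_less)
  qed simp_all
qed

text \<open>A compact set carrying almost all the mass is covered by finitely many neighbourhoods,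
  and a point receives the first index whose neighbourhood contains it. The value \<open>n\<close>
  is the leftover label, outside the compact set.\<close>

lemma neighbourhood_index:
  fixes U :: "'x \<Rightarrow> 'x set"
  assumes U: "\<And>x. open (U x)" "\<And>x. x \<in> U x" and \<kappa>: "0 < \<kappa>"
  obtains n p \<iota> where "\<iota> \<in> \<mu> \<rightarrow>\<^sub>M count_space (UNIV :: nat set)" "\<And>x. \<iota> x \<le> n"
    "\<And>x. \<iota> x < n \<Longrightarrow> x \<in> U (p (\<iota> x))" "prob {x. \<iota> x = n} \<le> \<kappa>"
proof -
  obtain K where K: "compact K" "prob UNIV \<le> prob K + \<kappa>"
    using compact_core[of UNIV \<kappa>] \<kappa> by auto
  have "K \<subseteq> (\<Union>x\<in>UNIV. U x)" using U(2) by auto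
  then obtain P where P: "finite P" "K \<subseteq> (\<Union>x\<in>P. U x)"
    using compactE_image[OF K(1), of UNIV U] U(1) by metis
  obtain p n where p: "P = p ` {i::nat. i < n}"
    using finite_imp_nat_seg_image_inj_on[OF P(1)] by blast
  \<comment> \<open>The alternative \<open>i = n\<close> makes the least element exist for every
    point; taking the least one makes the index a measurable function.\<close>
  define \<iota> where "\<iota> x = (LEAST i. i = n \<or> x \<in> U (p i))" for x
  have U': "U (p i) \<in> sets \<mu>" for i using U(1) by simp
  show ?thesis
  proof (rule that)
    show "\<iota> \<in> \<mu> \<rightarrow>\<^sub>M count_space UNIV"
      unfolding \<iota>_def using U' by measurable
    show le: "\<iota> x \<le> n" for x unfolding \<iota>_def by (rule Least_le) simp
    have LI: "\<iota> x = n \<or> x \<in> U (p (\<iota> x))" for x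
      unfolding \<iota>_def by (rule LeastI[of _ n]) simp
    then show "\<iota> x < n \<Longrightarrow> x \<in> U (p (\<iota> x))" for x by (metis less_irrefl)
    have "{x. \<iota> x = n} \<subseteq> - K"
    proof safe
      fix x assume "x \<in> K"
      then obtain i where i: "i < n" "x \<in> U (p i)" using P(2) p by auto
      then have "\<iota> x \<le> i" unfolding \<iota>_def by (intro Least_le) auto
      moreover assume "n = \<iota> x"
      ultimately show False using i by simp
    qed
    then have "prob {x. \<iota> x = n} \<le> prob (- K)"
      using K(1) by (intro finite_measure_mono) (auto intro: borel_compact borel_comp)
    also have "\<dots> \<le> \<kappa>"
      using prob_compl[of K] K by (simp add: borel_compact Compl_eq_Diff_UNIV prob_space[simplified])
    finally show "prob {x. \<iota> x = n} \<le> \<kappa>" .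
  qed
qed

section \<open>Itineraries\<close>

lemma itinerary_eq_iff:
  assumes "c \<in> F \<rightarrow>\<^sub>E B"
  shows "obs_itinerary G act F \<beta> x = c \<longleftrightarrow> (\<forall>g\<in>F. \<beta> (act (inv g) x) = c g)"
  using assms unfolding obs_itinerary_def by (auto simp: fun_eq_iff restrict_def PiE_def extensional_def)

lemma observable_in: "observable \<mu> B \<beta> \<Longrightarrow> \<beta> x \<in> B"
  unfolding observable_def by (auto dest: measurable_space)

lemma itinerary_in:
  "observable \<mu> B \<beta> \<Longrightarrow> F \<subseteq> carrier G \<Longrightarrow> obs_itinerary G act F \<beta> x \<in> F \<rightarrow>\<^sub>E B"
  by (auto simp: obs_itinerary_def observable_in)

lemma observable_vimage:
  assumes "observable \<mu> B \<beta>"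
  shows "{x. \<beta> x \<in> S} \<in> sets borel"
proof -
  have "\<beta> -` (S \<inter> B) \<inter> space \<mu> \<in> sets \<mu>"
    using assms unfolding observable_def by (intro measurable_sets[of \<beta>]) auto
  also have "\<beta> -` (S \<inter> B) \<inter> space \<mu> = {x. \<beta> x \<in> S}"
    using observable_in[OF assms] by auto
  finally show ?thesis by simp
qed

lemma itinerary_vimage:
  assumes \<beta>: "observable \<mu> B \<beta>" and F: "finite F" "F \<subseteq> carrier G"
  shows "{x. obs_itinerary G act F \<beta> x \<in> S} \<in> sets borel"
proof -
  have fin: "finite (F \<rightarrow>\<^sub>E B)" using \<beta> F by (auto simp: observable_def intro: finite_PiE)
  have "{x. obs_itinerary G act F \<beta> x = c} \<in> sets borel" if c: "c \<in> F \<rightarrow>\<^sub>E B" for c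
  proof -
    have "{x. \<beta> (act (inv g) x) = c g} \<in> sets \<mu>" if "g \<in> F" for g
      using measurable_sets[OF measurable_act observable_vimage[OF \<beta>, of "{c g}"], of "inv g"] that F
      by (auto simp: vimage_def)
    then have "{x\<in>space \<mu>. \<forall>g\<in>F. \<beta> (act (inv g) x) = c g} \<in> sets \<mu>"
      using F by (intro sets.sets_Collect_finite_All) auto
    then show ?thesis by (simp add: itinerary_eq_iff[OF c])
  qed
  then have "(\<Union>c\<in>S \<inter> (F \<rightarrow>\<^sub>E B). {x. obs_itinerary G act F \<beta> x = c}) \<in> sets borel"
    using fin by (intro sets.finite_UN) auto
  also have "(\<Union>c\<in>S \<inter> (F \<rightarrow>\<^sub>E B). {x. obs_itinerary G act F \<beta> x = c}) = {x. obs_itinerary G act F \<beta> x \<in> S}"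
    using itinerary_in[OF \<beta> F(2)] by auto
  finally show ?thesis .
qed

lemma sum_prob_itinerary:
  assumes \<beta>: "observable \<mu> B \<beta>" and F: "finite F" "F \<subseteq> carrier G" and S: "S \<subseteq> F \<rightarrow>\<^sub>E B"
  shows "(\<Sum>c\<in>S. prob (obs_itinerary G act F \<beta> -` {c} \<inter> space \<mu>)) = prob {x. obs_itinerary G act F \<beta> x \<in> S}"
proof -
  have "finite (F \<rightarrow>\<^sub>E B)" using \<beta> F by (auto simp: observable_def intro: finite_PiE)
  then have fin: "finite S" using S by (rule finite_subset[rotated])
  have "prob (\<Union>c\<in>S. obs_itinerary G act F \<beta> -` {c} \<inter> space \<mu>)
      = (\<Sum>c\<in>S. prob (obs_itinerary G act F \<beta> -` {c} \<inter> space \<mu>))"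
    using itinerary_vimage[OF \<beta> F, of "{_}"] fin
    by (intro finite_measure_finite_Union) (auto simp: disjoint_family_on_def vimage_def)
  moreover have "(\<Union>c\<in>S. obs_itinerary G act F \<beta> -` {c} \<inter> space \<mu>) = {x. obs_itinerary G act F \<beta> x \<in> S}"
    by auto
  ultimately show ?thesis by metis
qed

section \<open>Pattern frequencies compared with itinerary probabilities\<close>

lemma sum_freq_eq:
  assumes "finite S"
  shows "(\<Sum>c\<in>S. freq n (\<psi> -` {c})) = freq n {j. \<psi> j \<in> S}"
proof -
  have "(\<Sum>c\<in>S. freq n (\<psi> -` {c})) = freq n (\<Union>c\<in>S. \<psi> -` {c})"
    using assms by (intro freq_sum_disjoint) (auto simp: disjoint_family_on_def)
  also have "(\<Union>c\<in>S. \<psi> -` {c}) = {j. \<psi> j \<in> S}" by auto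
  finally show ?thesis .
qed

text \<open>The first condition in \<open>AP\<close> bounds a sum of absolute differences over all
  patterns, hence also the excess on any set of patterns.\<close>

lemma AP_freq_le:
  assumes \<psi>: "\<psi> \<in> AP G act \<mu> B \<beta> F \<delta> n s" and \<beta>: "observable \<mu> B \<beta>"
    and F: "finite F" "F \<subseteq> carrier G" and S: "S \<subseteq> F \<rightarrow>\<^sub>E B"
  shows "freq n {j. \<psi> j \<in> S} \<le> prob {x. obs_itinerary G act F \<beta> x \<in> S} + \<delta>"
proof -
  have fin: "finite (F \<rightarrow>\<^sub>E B)" using \<beta> F by (auto simp: observable_def intro: finite_PiE)
  let ?q = "\<lambda>c. prob (obs_itinerary G act F \<beta> -` {c} \<inter> space \<mu>)"
  have "freq n {j. \<psi> j \<in> S} = (\<Sum>c\<in>S. freq n (\<psi> -` {c}))"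
    using fin S by (intro sum_freq_eq[symmetric]) (rule finite_subset)
  also have "\<dots> \<le> (\<Sum>c\<in>S. ?q c + \<bar>freq n (\<psi> -` {c}) - ?q c\<bar>)"
    by (intro sum_mono) auto
  also have "\<dots> = prob {x. obs_itinerary G act F \<beta> x \<in> S} + (\<Sum>c\<in>S. \<bar>freq n (\<psi> -` {c}) - ?q c\<bar>)"
    by (simp only: sum.distrib sum_prob_itinerary[OF \<beta> F S])
  also have "(\<Sum>c\<in>S. \<bar>freq n (\<psi> -` {c}) - ?q c\<bar>) \<le> (\<Sum>c\<in>F \<rightarrow>\<^sub>E B. \<bar>freq n (\<psi> -` {c}) - ?q c\<bar>)"
    using fin S by (intro sum_mono2) auto
  also have "\<dots> \<le> \<delta>" using \<psi> by (simp add: AP_def)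
  finally show ?thesis by simp
qed

lemma AP_mono: "\<delta> \<le> \<delta>' \<Longrightarrow> AP G act \<mu> B \<beta> F \<delta> n s \<subseteq> AP G act \<mu> B \<beta> F \<delta>' n s"
  unfolding AP_def by force

lemma Map_mu_mono:
  "F' \<subseteq> F \<Longrightarrow> \<delta> \<le> \<delta>' \<Longrightarrow> L' \<subseteq> L \<Longrightarrow> Map_mu act \<mu> \<Delta> F \<delta> L n s \<subseteq> Map_mu act \<mu> \<Delta> F' \<delta>' L' n s"
  unfolding Map_mu_def by (auto; meson less_le_trans subsetD)

section \<open>From models to microstates\<close>

text \<open>The inverse permutation, except at the identity, where \<sigma> is only asymptotically
  trivial. Forcing \<open>id\<close> there makes the label at the identity of a microstate depend on
  the model at that same index.\<close>

definition \<tau> :: "nat \<Rightarrow> 'g \<Rightarrow> nat \<Rightarrow> nat" where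
  "\<tau> i g = (if g = \<one> then id else inv_into UNIV (\<sigma> i g))"

lemma permutes_\<tau>: "g \<in> carrier G \<Longrightarrow> \<tau> i g permutes {1..d i}"
  unfolding \<tau>_def using permutes_inv[OF permutes_\<sigma>] permutes_id by auto

lemma freq_not_tendsto_0:
  assumes "(\<lambda>i. freq (d i) {k. P i k}) \<longlonglongrightarrow> 1"
  shows "(\<lambda>i. freq (d i) {k. \<not> P i k}) \<longlonglongrightarrow> 0"
proof -
  have "freq (d i) {k. \<not> P i k} = 1 - freq (d i) {k. P i k}" for i
    using freq_compl[of "d i" "{k. P i k}"] by (simp add: Collect_neg_eq)
  then show ?thesis using tendsto_diff[OF tendsto_const assms, of 1] by simp
qed

lemma sofic_mult:
  "g \<in> carrier G \<Longrightarrow> h \<in> carrier G \<Longrightarrow>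
    (\<lambda>i. freq (d i) {k. \<sigma> i g (\<sigma> i h k) \<noteq> \<sigma> i (g \<otimes> h) k}) \<longlonglongrightarrow> 0"
  using sofic by (intro freq_not_tendsto_0) (simp add: sofic_approximation_def)

text \<open>Where \<open>\<sigma> i \<one>\<close> is multiplicative with itself, one factor cancels
  by injectivity and leaves a fixed point.\<close>

lemma \<sigma>_one_tendsto: "(\<lambda>i. freq (d i) {j. \<sigma> i \<one> j \<noteq> j}) \<longlonglongrightarrow> 0"
proof -
  have "\<sigma> i \<one> (\<sigma> i \<one> j) = \<sigma> i (\<one> \<otimes> \<one>) j \<longleftrightarrow> \<sigma> i \<one> j = j" for i j
    using permutes_inj[OF permutes_\<sigma>[of \<one> i]] by (auto simp: inj_def)
  then show ?thesis using sofic_mult[of \<one> \<one>] by simp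
qed

text \<open>Substituting \<open>\<sigma> i g k\<close> for \<open>j\<close> turns the defect into
  the failure of multiplicativity for the pair \<open>f \<otimes> inv g\<close> and
  \<open>g\<close>, whose product is \<open>f\<close>.\<close>

lemma \<sigma>_\<tau>_tendsto:
  assumes fg: "f \<in> carrier G" "g \<in> carrier G"
  shows "(\<lambda>i. freq (d i) {j. \<sigma> i f (\<tau> i g j) \<noteq> \<sigma> i (f \<otimes> inv g) j}) \<longlonglongrightarrow> 0"
proof (cases "g = \<one>")
  case True
  then show ?thesis using fg by (simp add: \<tau>_def)
next
  case False
  have "freq (d i) {j. \<sigma> i f (\<tau> i g j) \<noteq> \<sigma> i (f \<otimes> inv g) j}
      = freq (d i) {k. \<sigma> i (f \<otimes> inv g) (\<sigma> i g k) \<noteq> \<sigma> i (f \<otimes> inv g \<otimes> g) k}" for i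
  proof -
    have "f \<otimes> inv g \<otimes> g = f" using fg by (simp add: m_assoc)
    moreover have "\<tau> i g (\<sigma> i g k) = k" for k
      using False permutes_inverses(2)[OF permutes_\<sigma>[OF fg(2)]] by (simp add: \<tau>_def)
    ultimately show ?thesis
      using freq_permutes[OF d_pos permutes_\<sigma>[OF fg(2)],
          where P="\<lambda>j. \<sigma> i f (\<tau> i g j) \<noteq> \<sigma> i (f \<otimes> inv g) j"]
      by (simp add: eq_commute)
  qed
  then show ?thesis using sofic_mult[of "f \<otimes> inv g" g] fg by simp
qed

text \<open>Both points are compared with \<open>\<phi> (\<sigma> i (f \<otimes> inv g) j)\<close>.
  Outside the soficity defect each comparison is an equivariance error of the model, and Chebyshev's
  inequality at distance \<open>r / 2\<close> costs \<open>4 * \<delta>\<^sup>2 / r\<^sup>2\<close>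
  for each.\<close>

lemma equivariance_defect:
  assumes fg: "f \<in> carrier G" "g \<in> carrier G" and r: "0 < r"
    and f: "Delta2 \<Delta> (d i) (\<phi> \<circ> \<sigma> i f) (act f \<circ> \<phi>) < \<delta>"
    and h: "Delta2 \<Delta> (d i) (\<phi> \<circ> \<sigma> i (f \<otimes> inv g)) (act (f \<otimes> inv g) \<circ> \<phi>) < \<delta>"
  shows "freq (d i) {j. r \<le> \<Delta> (act f (\<phi> (\<tau> i g j))) (act f (act (inv g) (\<phi> j)))}
    \<le> freq (d i) {j. \<sigma> i f (\<tau> i g j) \<noteq> \<sigma> i (f \<otimes> inv g) j} + 8 * \<delta>\<^sup>2 / r\<^sup>2"
proof -
  let ?D = "\<lambda>h j. r / 2 \<le> \<Delta> (\<phi> (\<sigma> i h j)) (act h (\<phi> j))"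
  let ?S0 = "{j. \<sigma> i f (\<tau> i g j) \<noteq> \<sigma> i (f \<otimes> inv g) j}"
  have D: "freq (d i) {j. ?D h j} \<le> 4 * \<delta>\<^sup>2 / r\<^sup>2"
    if "Delta2 \<Delta> (d i) (\<phi> \<circ> \<sigma> i h) (act h \<circ> \<phi>) < \<delta>" for h
    using freq_ge_le_Delta2[OF d_pos, of "r / 2" \<Delta> i "\<phi> \<circ> \<sigma> i h" "act h \<circ> \<phi>" \<delta>] that r
    by (simp add: power_divide field_simps)
  have "{j. r \<le> \<Delta> (act f (\<phi> (\<tau> i g j))) (act f (act (inv g) (\<phi> j)))}
      \<subseteq> ?S0 \<union> ({j. ?D f (\<tau> i g j)} \<union> {j. ?D (f \<otimes> inv g) j})"
  proof (rule subsetI, rule ccontr)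
    fix j
    assume j: "j \<in> {j. r \<le> \<Delta> (act f (\<phi> (\<tau> i g j))) (act f (act (inv g) (\<phi> j)))}"
      and "j \<notin> ?S0 \<union> ({j. ?D f (\<tau> i g j)} \<union> {j. ?D (f \<otimes> inv g) j})"
    then have "\<Delta> (\<phi> (\<sigma> i (f \<otimes> inv g) j)) (act f (\<phi> (\<tau> i g j))) < r / 2"
      "\<Delta> (\<phi> (\<sigma> i (f \<otimes> inv g) j)) (act f (act (inv g) (\<phi> j))) < r / 2"
      using fg by (auto simp: act_mult)
    moreover have "\<Delta> (act f (\<phi> (\<tau> i g j))) (act f (act (inv g) (\<phi> j)))
        \<le> \<Delta> (act f (\<phi> (\<tau> i g j))) (\<phi> (\<sigma> i (f \<otimes> inv g) j))
          + \<Delta> (\<phi> (\<sigma> i (f \<otimes> inv g) j)) (act f (act (inv g) (\<phi> j)))"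
      by (rule \<Delta>_tri)
    ultimately show False using j by (simp add: \<Delta>_sym)
  qed
  then have "freq (d i) {j. r \<le> \<Delta> (act f (\<phi> (\<tau> i g j))) (act f (act (inv g) (\<phi> j)))}
      \<le> freq (d i) (?S0 \<union> ({j. ?D f (\<tau> i g j)} \<union> {j. ?D (f \<otimes> inv g) j}))"
    by (intro freq_mono d_pos) auto
  also have "\<dots> \<le> freq (d i) ?S0 + (freq (d i) {j. ?D f (\<tau> i g j)} + freq (d i) {j. ?D (f \<otimes> inv g) j})"
    by (intro order_trans[OF freq_Un_le] add_left_mono freq_Un_le)
  also have "freq (d i) {j. ?D f (\<tau> i g j)} = freq (d i) {j. ?D f j}"
    by (rule freq_permutes[OF d_pos permutes_\<tau>[OF fg(2)]])
  also have "freq (d i) ?S0 + (freq (d i) {j. ?D f j} + freq (d i) {j. ?D (f \<otimes> inv g) j})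
      \<le> freq (d i) ?S0 + (4 * \<delta>\<^sup>2 / r\<^sup>2 + 4 * \<delta>\<^sup>2 / r\<^sup>2)"
    by (intro add_mono D f h order_refl)
  finally show ?thesis by simp
qed

text \<open>A point of the itinerary cell missing from the closed set has some translate in a cell
  minus its core. By invariance each of the \<open>card F\<close> translates of such a remainder has
  measure at most \<open>\<zeta> / card F\<close>.\<close>

lemma itinerary_approx_compact:
  assumes \<beta>: "observable \<mu> B \<beta>" and F: "finite F" "F \<noteq> {}" "F \<subseteq> carrier G" and c: "c \<in> F \<rightarrow>\<^sub>E B"
    and K: "\<And>b. b \<in> B \<Longrightarrow> compact (K b)" "\<And>b. b \<in> B \<Longrightarrow> K b \<subseteq> {x. \<beta> x = b}"
    "\<And>b. b \<in> B \<Longrightarrow> prob {x. \<beta> x = b} \<le> prob (K b) + \<zeta> / real (card F)"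
  shows "prob {x. obs_itinerary G act F \<beta> x = c} \<le> prob {x. \<forall>g\<in>F. act (inv g) x \<in> K (c g)} + \<zeta>"
    and "closed {x. \<forall>g\<in>F. act (inv g) x \<in> K (c g)}"
proof -
  let ?C = "{x. \<forall>g\<in>F. act (inv g) x \<in> K (c g)}"
  let ?D = "\<lambda>g. {x. \<beta> x = c g} - K (c g)"
  have cB: "c g \<in> B" if "g \<in> F" for g using c that by auto
  have meas_b: "{x. \<beta> x = b} \<in> sets borel" for b
    using observable_vimage[OF \<beta>, of "{b}"] by simp
  have "closed ((\<lambda>x. act (inv g) x) -` K (c g))" if "g \<in> F" for g
    using that F K(1) cB by (intro closed_vimage compact_imp_closed continuous_act) auto
  then have "closed (\<Inter>g\<in>F. act (inv g) -` K (c g))" by (intro closed_INT) auto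
  also have "(\<Inter>g\<in>F. act (inv g) -` K (c g)) = ?C" by auto
  finally show C: "closed ?C" .
  have D_meas: "?D g \<in> sets borel" if "g \<in> F" for g
    using meas_b K(1)[OF cB[OF that]] by (auto intro: borel_compact)
  have D_meas': "{x. act (inv g) x \<in> ?D g} \<in> sets borel" if "g \<in> F" for g
    using measurable_sets[OF measurable_act D_meas[OF that], of "inv g"] that F(3)
    by (auto simp: vimage_def)
  have "{x. obs_itinerary G act F \<beta> x = c} \<subseteq> ?C \<union> (\<Union>g\<in>F. {x. act (inv g) x \<in> ?D g})"
    by (auto simp: itinerary_eq_iff[OF c])
  then have "prob {x. obs_itinerary G act F \<beta> x = c} \<le> prob (?C \<union> (\<Union>g\<in>F. {x. act (inv g) x \<in> ?D g}))"
    using C D_meas' F(1) by (intro finite_measure_mono sets.Un sets.finite_UN) auto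
  also have "\<dots> \<le> prob ?C + prob (\<Union>g\<in>F. {x. act (inv g) x \<in> ?D g})"
    using C D_meas' F(1) by (intro measure_Un_le sets.finite_UN) auto
  also have "prob (\<Union>g\<in>F. {x. act (inv g) x \<in> ?D g}) \<le> (\<Sum>g\<in>F. prob {x. act (inv g) x \<in> ?D g})"
    using D_meas' F(1) by (intro measure_UNION_le) auto
  also have "\<dots> \<le> (\<Sum>g\<in>F. \<zeta> / real (card F))"
  proof (rule sum_mono)
    fix g assume g: "g \<in> F"
    have "prob {x. act (inv g) x \<in> ?D g} = prob (?D g)"
      using g F(3) D_meas[OF g] by (intro prob_act) auto
    also have "\<dots> = prob {x. \<beta> x = c g} - prob (K (c g))"
      using meas_b K(1,2)[OF cB[OF g]] by (intro finite_measure_Diff) (auto intro: borel_compact)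
    finally show "prob {x. act (inv g) x \<in> ?D g} \<le> \<zeta> / real (card F)"
      using K(3)[OF cB[OF g]] by simp
  qed
  also have "\<dots> = \<zeta>" using F by simp
  finally show "prob {x. obs_itinerary G act F \<beta> x = c} \<le> prob ?C + \<zeta>" by simp
qed

text \<open>The test function lies between the indicators of \<open>C\<close> and \<open>V\<close>:
  integrating against \<mu> uses the lower one, against the empirical measure the upper one.\<close>

lemma Map_mu_freq_ge:
  assumes \<phi>: "\<phi> \<in> Map_mu act \<mu> \<Delta> F \<delta> L n s" and h: "h \<in> L" and n: "0 < n"
    and h01: "\<And>x. 0 \<le> h x" "\<And>x. h x \<le> 1" and hC: "\<And>x. x \<in> C \<Longrightarrow> h x = 1"
    and hV: "\<And>x. x \<notin> V \<Longrightarrow> h x = 0" and C: "C \<in> sets borel"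
  shows "prob C - \<delta> \<le> freq n {j. \<phi> j \<in> V}"
proof -
  have cont: "continuous_on UNIV (apply_bcontfun h)" by (rule continuous_on_apply_bcontfun)
  have "prob C = expectation (\<lambda>x. indicator C x)" using C by simp
  also have "\<dots> \<le> expectation h"
  proof (rule integral_mono)
    show "integrable \<mu> (\<lambda>x. indicator C x :: real)" using C by (simp add: integrable_indicator_iff emeasure_eq_measure)
    show "integrable \<mu> (apply_bcontfun h)"
      using h01 borel_measurable_continuous_onI[OF cont]
      by (intro integrable_const_bound[of _ 1]) auto
    show "indicator C x \<le> h x" for x using h01 hC by (auto simp: indicator_def)
  qed
  also have "\<dots> < measure_pmf.expectation (map_pmf \<phi> (unif n)) h + \<delta>"
    using \<phi> h by (auto simp: Map_mu_def)
  also have "measure_pmf.expectation (map_pmf \<phi> (unif n)) h = (\<Sum>j=1..n. h (\<phi> j)) / real n"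
    using n by (simp add: expectation_unif)
  also have "(\<Sum>j=1..n. h (\<phi> j)) \<le> (\<Sum>j=1..n. indicator {j. \<phi> j \<in> V} j)"
    using h01 hV by (intro sum_mono) (auto simp: indicator_def)
  also have "(\<Sum>j=1..n. indicator {j. \<phi> j \<in> V} j) / real n = freq n {j. \<phi> j \<in> V}"
    using n by (simp add: freq_eq_card indicator_def sum.If_cases)
  finally show ?thesis using n by (simp add: divide_right_mono)
qed

lemma finite_AP:
  assumes "observable \<mu> B \<beta>" "finite F"
  shows "finite (AP G act \<mu> B \<beta> F \<delta> n s)"
proof -
  have "finite ({1..n} \<rightarrow>\<^sub>E (F \<rightarrow>\<^sub>E B))"
    using assms by (intro finite_PiE) (auto simp: observable_def)
  then show ?thesis unfolding AP_def by (rule rev_finite_subset) auto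
qed

text \<open>A model \<open>\<phi>\<close> of the pseudometric is turned into a microstate by reading off the labels of
  small neighbourhoods of compact cores of the cells of \<open>\<beta>\<close>. Since the pattern frequencies of the
  microstate and of \<open>\<mu>\<close> both sum to one, one-sided estimates of them suffice.\<close>

lemma shadow_microstate:
  fixes E :: "'b \<Rightarrow> 'x set"
  assumes \<beta>: "observable \<mu> B \<beta>" and F': "finite F'" "F' \<subseteq> carrier G" "\<one> \<in> F'"
    and \<xi>: "0 < \<xi>" and r0: "0 < r0"
    and E: "\<And>b. b \<in> B \<Longrightarrow> E b \<in> sets borel" "\<And>b. b \<in> B \<Longrightarrow> E b \<subseteq> {x. \<beta> x = b}"
      "\<And>b. b \<in> B \<Longrightarrow> prob {x. \<beta> x = b} = prob (E b)"
  obtains F \<delta> L where "finite F" "F \<subseteq> carrier G" "0 < \<delta>" "finite L"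
    "\<forall>\<^sub>F i in sequentially. \<forall>\<phi>\<in>Map_mu act \<mu> \<Delta> F \<delta> L (d i) (\<sigma> i). \<exists>\<psi>\<in>AP G act \<mu> B \<beta> F' \<xi> (d i) (\<sigma> i).
       freq (d i) {j. \<not> (\<exists>y\<in>E (\<psi> j \<one>). \<Delta> (\<phi> j) y < r0)} \<le> \<xi>"
proof -
  let ?I = "F' \<rightarrow>\<^sub>E B"
  have B: "finite B" using \<beta> by (simp add: observable_def)
  then have finI: "finite ?I" using F' by (intro finite_PiE) auto
  obtain b0 where b0: "b0 \<in> B" using observable_in[OF \<beta>] by blast
  have F'_ne: "F' \<noteq> {}" using F' by auto
  \<comment> \<open>Each pattern frequency will be bounded below up to \<open>3 * \<zeta>\<close>;
    doubling and summing over all patterns stays below \<xi>.\<close>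
  define \<zeta> where "\<zeta> = \<xi> / (8 * (real (card ?I) + 1))"
  have \<zeta>: "0 < \<zeta>" using \<xi> by (simp add: \<zeta>_def add_nonneg_pos)
  have \<zeta>\<xi>: "6 * (real (card ?I) * \<zeta>) < \<xi>"
    using \<xi> by (simp add: \<zeta>_def field_simps add_pos_nonneg)
  have disj: "disjoint_family_on E B"
    using E(2) by (auto simp: disjoint_family_on_def)
  have \<zeta>F': "0 < \<zeta> / real (card F')" using \<zeta> F' F'_ne by (simp add: card_gt_0_iff)
  obtain K F0 r1 where K: "\<And>b. b \<in> B \<Longrightarrow> compact (K b)" "\<And>b. b \<in> B \<Longrightarrow> K b \<subseteq> E b"
      "\<And>b. b \<in> B \<Longrightarrow> prob (E b) \<le> prob (K b) + \<zeta> / real (card F')"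
    and F0: "finite F0" "F0 \<subseteq> carrier G" "\<one> \<in> F0" and r1: "0 < r1"
    and sep: "\<And>b b' x y. b \<in> B \<Longrightarrow> b' \<in> B \<Longrightarrow> b \<noteq> b' \<Longrightarrow> x \<in> K b \<Longrightarrow> y \<in> K b' \<Longrightarrow> \<not> near F0 r1 x y"
    using separated_cores[OF B E(1) disj \<zeta>F'] by metis
  \<comment> \<open>Two cores within \<open>2 * r\<close> of one point would be within
    \<open>4 * r\<close> of each other, which must not exceed the separation
    \<open>r1\<close>.\<close>
  define r where "r = min (r1 / 4) r0"
  have r: "0 < r" "r \<le> r0" "4 * r \<le> r1" using r1 r0 by (auto simp: r_def)
  define C where "C = (\<lambda>c. {x. \<forall>g\<in>F'. act (inv g) x \<in> K (c g)})"
  \<comment> \<open>\<open>V c\<close> is an open neighbourhood of the closed core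
    \<open>C c\<close> of the itinerary cell of \<open>c\<close>, and it is thin enough that
    distinct patterns give disjoint sets.\<close>
  define V where "V = (\<lambda>c. {x. \<forall>g\<in>F'. \<exists>y\<in>K (c g). near F0 r (act (inv g) x) y})"
  have K\<beta>: "K b \<subseteq> {x. \<beta> x = b}" "prob {x. \<beta> x = b} \<le> prob (K b) + \<zeta> / real (card F')" if "b \<in> B" for b
    using K(2,3)[OF that] E(2,3)[OF that] by auto
  have C_prob: "prob {x. obs_itinerary G act F' \<beta> x = c} \<le> prob (C c) + \<zeta>"
    and C_closed: "closed (C c)" if c: "c \<in> ?I" for c
    unfolding C_def
    using itinerary_approx_compact[OF \<beta> F'(1) F'_ne F'(2) c K(1) K\<beta>] by blast+
  have V_open: "open (V c)" for c
  proof -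
    have "open ((\<lambda>x. act (inv g) x) -` {z. \<exists>y\<in>K (c g). near F0 r z y})" if "g \<in> F'" for g
    proof (rule open_vimage)
      have "open (\<Union>y\<in>K (c g). {z. near F0 r z y})"
        using open_near[OF F0(1,2)] by (intro open_UN) auto
      also have "(\<Union>y\<in>K (c g). {z. near F0 r z y}) = {z. \<exists>y\<in>K (c g). near F0 r z y}" by auto
      finally show "open {z. \<exists>y\<in>K (c g). near F0 r z y}" .
      show "continuous_on UNIV (act (inv g))" using that F'(2) by (intro continuous_act) auto
    qed
    then have "open (\<Inter>g\<in>F'. act (inv g) -` {z. \<exists>y\<in>K (c g). near F0 r z y})"
      using F' by (intro open_INT) auto
    also have "(\<Inter>g\<in>F'. act (inv g) -` {z. \<exists>y\<in>K (c g). near F0 r z y}) = V c"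
      by (auto simp: V_def)
    finally show ?thesis .
  qed
  have near_refl: "near F0 r x x" for x using r by (simp add: near_def)
  have CV: "C c \<subseteq> V c" for c unfolding C_def V_def using near_refl by blast
  have "\<forall>c\<in>?I. \<exists>h :: 'x \<Rightarrow>\<^sub>C real. (\<forall>x. 0 \<le> h x \<and> h x \<le> 1) \<and> (\<forall>x\<in>C c. h x = 1) \<and> (\<forall>x. x \<notin> V c \<longrightarrow> h x = 0)"
    by (intro ballI urysohn_function C_closed V_open CV)
  from bchoice[OF this] obtain h :: "('g \<Rightarrow> 'b) \<Rightarrow> 'x \<Rightarrow>\<^sub>C real" where
    "\<forall>c\<in>?I. (\<forall>x. 0 \<le> h c x \<and> h c x \<le> 1) \<and> (\<forall>x\<in>C c. h c x = 1) \<and> (\<forall>x. x \<notin> V c \<longrightarrow> h c x = 0)"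
    by (rule exE)
  then have h: "0 \<le> h c x" "h c x \<le> 1" "x \<in> C c \<Longrightarrow> h c x = 1" "x \<notin> V c \<Longrightarrow> h c x = 0"
    if "c \<in> ?I" for c x
    using that by simp_all
  define m where "m = real (card (F0 \<times> F')) + 1"
  have m: "0 < m" by (simp add: m_def add_nonneg_pos)
  \<comment> \<open>The first bound controls the test integrals, the second makes the Chebyshev
    terms \<open>8 * \<delta>\<^sup>2 / r\<^sup>2\<close> of all pairs in
    \<open>F0 \<times> F'\<close> sum to at most half of \<zeta>; the soficity defects take the
    other half.\<close>
  define \<delta> where "\<delta> = min \<zeta> (r * sqrt (\<zeta> / (16 * m)))"
  have \<delta>: "0 < \<delta>" "\<delta> \<le> \<zeta>" using \<zeta> r m by (auto simp: \<delta>_def)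
  have "\<delta>\<^sup>2 \<le> (r * sqrt (\<zeta> / (16 * m)))\<^sup>2" using \<delta> by (intro power_mono) (auto simp: \<delta>_def)
  also have "\<dots> = r\<^sup>2 * (\<zeta> / (16 * m))" using \<zeta> m by (simp add: power_mult_distrib)
  finally have \<delta>r: "8 * \<delta>\<^sup>2 / r\<^sup>2 \<le> \<zeta> / (2 * m)" using r m by (simp add: field_simps)
  define F where "F = F0 \<union> (\<lambda>(f, g). f \<otimes> inv g) ` (F0 \<times> F')"
  have FG: "finite F" "F \<subseteq> carrier G" using F0 F' by (auto simp: F_def)
  have "\<forall>\<^sub>F i in sequentially. \<forall>t\<in>F0 \<times> F'.
      freq (d i) {j. \<sigma> i (fst t) (\<tau> i (snd t) j) \<noteq> \<sigma> i (fst t \<otimes> inv (snd t)) j} < \<zeta> / (2 * m)"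
    using F0 F' \<zeta> m
    by (intro eventually_ball_finite ballI order_tendstoD(2)[OF \<sigma>_\<tau>_tendsto]) auto
  moreover have "\<forall>\<^sub>F i in sequentially. freq (d i) {j. \<sigma> i \<one> j \<noteq> j} < \<xi>"
    using \<xi> by (intro order_tendstoD(2)[OF \<sigma>_one_tendsto])
  ultimately have "\<forall>\<^sub>F i in sequentially. \<forall>\<phi>\<in>Map_mu act \<mu> \<Delta> F \<delta> (h ` ?I) (d i) (\<sigma> i).
      \<exists>\<psi>\<in>AP G act \<mu> B \<beta> F' \<xi> (d i) (\<sigma> i). freq (d i) {j. \<not> (\<exists>y\<in>E (\<psi> j \<one>). \<Delta> (\<phi> j) y < r0)} \<le> \<xi>"
  proof (eventually_elim, intro ballI)
    fix i \<phi>
    assume ev1: "\<forall>t\<in>F0 \<times> F'.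
        freq (d i) {j. \<sigma> i (fst t) (\<tau> i (snd t) j) \<noteq> \<sigma> i (fst t \<otimes> inv (snd t)) j} < \<zeta> / (2 * m)"
      and ev2: "freq (d i) {j. \<sigma> i \<one> j \<noteq> j} < \<xi>"
      and \<phi>: "\<phi> \<in> Map_mu act \<mu> \<Delta> F \<delta> (h ` ?I) (d i) (\<sigma> i)"
    let ?bad = "\<lambda>t. {j. r \<le> \<Delta> (act (fst t) (\<phi> (\<tau> i (snd t) j))) (act (fst t) (act (inv (snd t)) (\<phi> j)))}"
    have "freq (d i) (\<Union>t\<in>F0 \<times> F'. ?bad t) \<le> (\<Sum>t\<in>F0 \<times> F'. freq (d i) (?bad t))"
      using F0 F' by (intro freq_UN_le) auto
    also have "\<dots> \<le> (\<Sum>t\<in>F0 \<times> F'. \<zeta> / (2 * m) + \<zeta> / (2 * m))"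
    proof (rule sum_mono)
      fix t assume t: "t \<in> F0 \<times> F'"
      then have "fst t \<in> F" "fst t \<otimes> inv (snd t) \<in> F" by (force simp: F_def)+
      then have "freq (d i) (?bad t)
          \<le> freq (d i) {j. \<sigma> i (fst t) (\<tau> i (snd t) j) \<noteq> \<sigma> i (fst t \<otimes> inv (snd t)) j} + 8 * \<delta>\<^sup>2 / r\<^sup>2"
        using t F0(2) F'(2) r(1) \<phi> by (intro equivariance_defect) (auto simp: Map_mu_def)
      also have "\<dots> \<le> \<zeta> / (2 * m) + \<zeta> / (2 * m)"
        using ev1 t \<delta>r by (intro add_mono) (auto intro: less_imp_le)
      finally show "freq (d i) (?bad t) \<le> \<zeta> / (2 * m) + \<zeta> / (2 * m)" .
    qed
    also have "\<dots> = real (card (F0 \<times> F')) * (\<zeta> / m)" using m by (simp add: field_simps)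
    also have "\<dots> \<le> \<zeta>" using m \<zeta> by (simp add: m_def field_simps)
    finally have bad: "freq (d i) (\<Union>t\<in>F0 \<times> F'. ?bad t) \<le> \<zeta>" .
    \<comment> \<open>The label of a core within \<open>2 * r\<close> if there is one, and otherwise
      an arbitrary element of \<open>B\<close>, so that the microstate takes values in patterns
      everywhere.\<close>
    define lab where "lab x = (SOME b. b \<in> B \<and>
        ((\<exists>b'\<in>B. \<exists>y\<in>K b'. near F0 (2 * r) x y) \<longrightarrow> (\<exists>y\<in>K b. near F0 (2 * r) x y)))" for x
    have lab: "lab x \<in> B \<and>
        ((\<exists>b'\<in>B. \<exists>y\<in>K b'. near F0 (2 * r) x y) \<longrightarrow> (\<exists>y\<in>K (lab x). near F0 (2 * r) x y))" for x
      unfolding lab_def by (rule someI_ex) (use b0 in blast)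
    then have lab_B: "lab x \<in> B" for x by blast
    have lab_eq: "lab x = b" if b: "b \<in> B" "y \<in> K b" "near F0 (2 * r) x y" for x y b
    proof (rule ccontr)
      assume ne: "lab x \<noteq> b"
      obtain y' where y': "lab x \<in> B" "y' \<in> K (lab x)" "near F0 (2 * r) x y'"
        using lab[of x] b by blast
      have "near F0 (2 * r + 2 * r) y' y"
        using y'(3) b(3) near_tri near_sym by blast
      then have "near F0 r1 y' y" using r by (auto intro: near_mono)
      then show False using sep[OF y'(1) b(1) ne y'(2) b(2)] by simp
    qed
    define \<psi> where "\<psi> = (\<lambda>j\<in>{1..d i}. \<lambda>g\<in>F'. lab (\<phi> (\<tau> i g j)))"
    have \<psi>_in: "\<psi> \<in> {1..d i} \<rightarrow>\<^sub>E ?I" using lab_B by (auto simp: \<psi>_def)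
    \<comment> \<open>At a good index, \<open>\<phi> (\<tau> i g j)\<close> is within
      \<open>r\<close> of the translate of \<open>\<phi> j\<close>, which is within \<open>r\<close>
      of the core of \<open>c g\<close>; the total \<open>2 * r\<close> determines the
      label.\<close>
    have key: "\<psi> j = c"
      if j: "j \<in> {1..d i}" "j \<notin> (\<Union>t\<in>F0 \<times> F'. ?bad t)" and c: "c \<in> ?I" and Vj: "\<phi> j \<in> V c" for j c
    proof
      fix g show "\<psi> j g = c g"
      proof (cases "g \<in> F'")
        case True
        obtain y where y: "y \<in> K (c g)" "near F0 r (act (inv g) (\<phi> j)) y"
          using Vj True by (auto simp: V_def)
        have "near F0 r (\<phi> (\<tau> i g j)) (act (inv g) (\<phi> j))"
          using j(2) True by (force simp: near_def)
        then have "near F0 (2 * r) (\<phi> (\<tau> i g j)) y" using near_tri y(2) by fastforce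
        then have "lab (\<phi> (\<tau> i g j)) = c g" using c True y(1) by (intro lab_eq) auto
        then show ?thesis using j True by (simp add: \<psi>_def)
      next
        case False
        then show ?thesis using c j by (auto simp: \<psi>_def PiE_def extensional_def)
      qed
    qed
    have freqV: "prob {x. obs_itinerary G act F' \<beta> x = c} \<le> freq (d i) {j. \<phi> j \<in> V c} + 2 * \<zeta>"
      if c: "c \<in> ?I" for c
    proof -
      have "prob (C c) - \<delta> \<le> freq (d i) {j. \<phi> j \<in> V c}"
        using c C_closed[OF c] by (intro Map_mu_freq_ge[OF \<phi> _ d_pos, of "h c"] h[OF c]) auto
      then show ?thesis using C_prob[OF c] \<delta> by linarith
    qed
    \<comment> \<open>One \<zeta> is lost in passing to the closed core, one in the test integral,
      and one on the bad indices.\<close>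
    have one_sided: "prob (obs_itinerary G act F' \<beta> -` {c} \<inter> space \<mu>) \<le> freq (d i) (\<psi> -` {c}) + 3 * \<zeta>"
      if c: "c \<in> ?I" for c
    proof -
      have "freq (d i) {j. \<phi> j \<in> V c} \<le> freq (d i) (\<psi> -` {c} \<union> (\<Union>t\<in>F0 \<times> F'. ?bad t))"
        using key[OF _ _ c] by (intro freq_mono d_pos) blast
      also have "\<dots> \<le> freq (d i) (\<psi> -` {c}) + \<zeta>"
        using freq_Un_le bad by (rule order_trans[OF _ add_left_mono])
      finally show ?thesis using freqV[OF c] by (simp add: vimage_def)
    qed
    have "(\<Sum>c\<in>?I. freq (d i) (\<psi> -` {c})) = freq (d i) {j. \<psi> j \<in> ?I}"
      by (rule sum_freq_eq[OF finI])
    also have "\<dots> = freq (d i) UNIV" using \<psi>_in by (intro freq_cong d_pos) auto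
    also have "\<dots> = (\<Sum>c\<in>?I. prob (obs_itinerary G act F' \<beta> -` {c} \<inter> space \<mu>))"
      unfolding sum_prob_itinerary[OF \<beta> F'(1,2) order_refl] using itinerary_in[OF \<beta> F'(2)] prob_space by simp
    finally have "(\<Sum>c\<in>?I. \<bar>freq (d i) (\<psi> -` {c}) - prob (obs_itinerary G act F' \<beta> -` {c} \<inter> space \<mu>)\<bar>)
        \<le> 2 * real (card ?I) * (3 * \<zeta>)"
      using one_sided \<zeta> by (intro sum_abs_diff_le_of_one_sided) auto
    also have "\<dots> < \<xi>" using \<zeta>\<xi> by (simp add: mult_ac)
    finally have close: "(\<Sum>c\<in>?I. \<bar>freq (d i) (\<psi> -` {c}) - prob (obs_itinerary G act F' \<beta> -` {c} \<inter> space \<mu>)\<bar>) < \<xi>" .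
    \<comment> \<open>For \<open>g \<noteq> \<one>\<close> both sides read the same label by the
      definition of \<tau>; a mismatch can occur only at the identity, on indices moved by
      \<open>\<sigma> i \<one>\<close>.\<close>
    have equi: "freq (d i) {j. \<psi> j g \<noteq> \<psi> (inv_into UNIV (\<sigma> i g) j) \<one>} < \<xi>" if g: "g \<in> F'" for g
    proof -
      have gG: "g \<in> carrier G" using g F' by auto
      have "freq (d i) {j. \<psi> j g \<noteq> \<psi> (inv_into UNIV (\<sigma> i g) j) \<one>} \<le> freq (d i) {j. \<sigma> i \<one> j \<noteq> j}"
      proof (rule freq_mono[OF d_pos])
        fix j assume j: "j \<in> {1..d i}" and ne: "j \<in> {j. \<psi> j g \<noteq> \<psi> (inv_into UNIV (\<sigma> i g) j) \<one>}"
        have j': "inv_into UNIV (\<sigma> i g) j \<in> {1..d i}"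
          using permutes_in_image[OF permutes_inv[OF permutes_\<sigma>[OF gG]]] j by blast
        then have "\<psi> (inv_into UNIV (\<sigma> i g) j) \<one> = lab (\<phi> (inv_into UNIV (\<sigma> i g) j))"
          using F' by (simp add: \<psi>_def \<tau>_def)
        moreover have "\<psi> j g = lab (\<phi> (\<tau> i g j))" using j g by (simp add: \<psi>_def)
        ultimately have "\<tau> i g j \<noteq> inv_into UNIV (\<sigma> i g) j" using ne by auto
        then have "g = \<one>" "inv_into UNIV (\<sigma> i \<one>) j \<noteq> j" by (auto simp: \<tau>_def split: if_splits)
        then show "j \<in> {j. \<sigma> i \<one> j \<noteq> j}"
          using permutes_inverses(2)[OF permutes_\<sigma>[OF one_closed, of i], of j] by auto
      qed
      then show ?thesis using ev2 by simp
    qed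
    have AP: "\<psi> \<in> AP G act \<mu> B \<beta> F' \<xi> (d i) (\<sigma> i)"
      using \<psi>_in close equi by (simp add: AP_def)
    have V_disj: "disjoint_family_on (\<lambda>c. {j. \<phi> j \<in> V c}) ?I"
    proof (unfold disjoint_family_on_def, intro ballI impI)
      fix c c' assume c: "c \<in> ?I" "c' \<in> ?I" "c \<noteq> c'"
      then obtain g where g: "g \<in> F'" "c g \<noteq> c' g" by (meson PiE_ext)
      have False if x: "x \<in> V c" "x \<in> V c'" for x
      proof -
        obtain y y' where y: "y \<in> K (c g)" "near F0 r (act (inv g) x) y"
          "y' \<in> K (c' g)" "near F0 r (act (inv g) x) y'"
          using x g(1) unfolding V_def by blast
        then have "near F0 (r + r) y y'" using near_tri near_sym by blast
        then have "near F0 r1 y y'" using r by (auto intro: near_mono)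
        then show False using sep[OF _ _ g(2) y(1,3)] c g(1) by auto
      qed
      then show "{j. \<phi> j \<in> V c} \<inter> {j. \<phi> j \<in> V c'} = {}" by auto
    qed
    \<comment> \<open>The sets of indices belonging to the \<open>V c\<close> are disjoint and their
      total frequency is at least \<open>1 - 2 * card ?I * \<zeta>\<close>. At every such index the
      label at the identity is the right one and its core is close to the model.\<close>
    have "(\<Sum>c\<in>?I. prob (obs_itinerary G act F' \<beta> -` {c} \<inter> space \<mu>)) \<le> (\<Sum>c\<in>?I. freq (d i) {j. \<phi> j \<in> V c} + 2 * \<zeta>)"
      using freqV by (intro sum_mono) (simp add: vimage_def)
    then have "1 \<le> (\<Sum>c\<in>?I. freq (d i) {j. \<phi> j \<in> V c}) + 2 * (real (card ?I) * \<zeta>)"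
      unfolding sum_prob_itinerary[OF \<beta> F'(1,2) order_refl]
      using itinerary_in[OF \<beta> F'(2)] prob_space by (simp add: sum.distrib)
    also have "(\<Sum>c\<in>?I. freq (d i) {j. \<phi> j \<in> V c}) = freq (d i) (\<Union>c\<in>?I. {j. \<phi> j \<in> V c})"
      by (rule freq_sum_disjoint[OF finI V_disj])
    also have "\<dots> \<le> freq (d i) (- {j. \<not> (\<exists>y\<in>E (\<psi> j \<one>). \<Delta> (\<phi> j) y < r0)})"
    proof (rule freq_mono[OF d_pos])
      fix j assume j: "j \<in> {1..d i}" "j \<in> (\<Union>c\<in>?I. {j. \<phi> j \<in> V c})"
      then obtain c where c: "c \<in> ?I" "\<phi> j \<in> V c" by auto
      then have c1: "c \<one> \<in> B" using F'(3) by auto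
      obtain y where y: "y \<in> K (c \<one>)" "near F0 r (\<phi> j) y"
        using c(2) F'(3) by (auto simp: V_def)
      have "lab (\<phi> j) = c \<one>" using lab_eq[OF c1 y(1) near_mono[OF y(2)]] r by simp
      then have "\<psi> j \<one> = c \<one>" using j F'(3) by (simp add: \<psi>_def \<tau>_def)
      moreover have "\<Delta> (\<phi> j) y < r0"
        using y(2) F0(3) r(2) unfolding near_def by fastforce
      ultimately show "j \<in> - {j. \<not> (\<exists>y\<in>E (\<psi> j \<one>). \<Delta> (\<phi> j) y < r0)}"
        using K(2)[OF c1] y(1) by auto
    qed
    finally have "freq (d i) {j. \<not> (\<exists>y\<in>E (\<psi> j \<one>). \<Delta> (\<phi> j) y < r0)} \<le> \<xi>"
      using \<zeta>\<xi> \<zeta> unfolding freq_compl by (smt (verit) mult_nonneg_nonneg of_nat_0_le_iff)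
    with AP show "\<exists>\<psi>\<in>AP G act \<mu> B \<beta> F' \<xi> (d i) (\<sigma> i). freq (d i) {j. \<not> (\<exists>y\<in>E (\<psi> j \<one>). \<Delta> (\<phi> j) y < r0)} \<le> \<xi>"
      by blast
  qed
  then show ?thesis using FG \<delta>(1) finI by (intro that[of F \<delta> "h ` ?I"]) auto
qed

text \<open>\<alpha> depends only on \<epsilon> and must work against every refinement. It records a
  ball of radius \<open>\<epsilon> / 8\<close>, so models whose microstates give the same
  \<alpha>-word agree within \<open>\<epsilon> / 2\<close> at most indices, and separated models
  yield distinct words.\<close>

lemma ex_observable_h_Delta_eps_le:
  assumes \<epsilon>: "0 < \<epsilon>"
  shows "\<exists>A (\<alpha> :: 'x \<Rightarrow> nat). observable \<mu> A \<alpha> \<and>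
    (\<forall>B (\<beta> :: 'x \<Rightarrow> nat) \<pi>. observable \<mu> B \<beta> \<longrightarrow> refines_via \<mu> A \<alpha> B \<beta> \<pi> \<longrightarrow>
      h_Delta_eps G d \<sigma> act \<mu> \<Delta> \<epsilon> \<le> h_obs G d \<sigma> act \<mu> \<pi> B \<beta>)"
proof -
  obtain C where C: "0 < C" "\<And>x y. \<Delta> x y \<le> C" using \<Delta>_bound by blast
  \<comment> \<open>An exceptional frequency of \<open>4 * \<kappa>\<close> contributes
    \<open>\<epsilon>\<^sup>2 / 2\<close> to the squared distance; with
    \<open>(\<epsilon> / 2)\<^sup>2\<close> this is below \<open>\<epsilon>\<^sup>2\<close>.\<close>
  define \<kappa> where "\<kappa> = \<epsilon>\<^sup>2 / (8 * C\<^sup>2)"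
  have \<kappa>: "0 < \<kappa>" using \<epsilon> C(1) by (simp add: \<kappa>_def)
  have opn: "open {y. \<Delta> p y < \<epsilon> / 8}" and mem: "p \<in> {y. \<Delta> p y < \<epsilon> / 8}" for p
    using \<epsilon> by (auto intro!: open_Collect_less continuous_\<Delta>_comp continuous_intros)
  obtain n p \<iota> where \<iota>: "\<iota> \<in> \<mu> \<rightarrow>\<^sub>M count_space (UNIV :: nat set)" "\<And>x. \<iota> x \<le> n"
    "\<And>x. \<iota> x < n \<Longrightarrow> x \<in> {y. \<Delta> (p (\<iota> x)) y < \<epsilon> / 8}" "prob {x. \<iota> x = n} \<le> \<kappa>"
    by (rule neighbourhood_index[OF opn mem \<kappa>]) (rule that)
  have obs: "observable \<mu> {..n} \<iota>"
    unfolding observable_def using \<iota>(1,2)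
    by (auto intro!: measurable_count_space_extend[of "{..n}" UNIV])
  have "h_Delta_eps G d \<sigma> act \<mu> \<Delta> \<epsilon> \<le> h_obs G d \<sigma> act \<mu> \<pi> B \<beta>"
    if \<beta>: "observable \<mu> B \<beta>" and ref: "refines_via \<mu> {..n} \<iota> B \<beta> \<pi>" for B and \<beta> :: "'x \<Rightarrow> nat" and \<pi>
    unfolding h_obs_def
  proof (intro INF_greatest)
    fix F' \<delta>' assume "F' \<in> {F. finite F \<and> F \<subseteq> carrier G \<and> \<one> \<in> F}" and "\<delta>' \<in> {0::real<..}"
    then have F': "finite F'" "F' \<subseteq> carrier G" "\<one> \<in> F'" and \<delta>': "0 < \<delta>'" by auto
    \<comment> \<open>Refinement holds only almost everywhere. Cutting off the null part of each
      cell ensures that points of the remaining cell have the \<alpha>-label predicted by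
      \<pi>.\<close>
    define E where "E b = {x. \<beta> x = b \<and> \<iota> x = \<pi> b}" for b
    define \<xi> where "\<xi> = min \<delta>' \<kappa>"
    have \<xi>: "0 < \<xi>" "\<xi> \<le> \<delta>'" "\<xi> \<le> \<kappa>" using \<delta>' \<kappa> by (auto simp: \<xi>_def)
    have meas_\<beta>: "{x. \<beta> x = b} \<in> sets borel" for b
      using observable_vimage[OF \<beta>, of "{b}"] by simp
    have meas_E: "E b \<in> sets borel" for b
    proof -
      have "{x. \<beta> x = b} \<inter> {x. \<iota> x = \<pi> b} \<in> sets borel"
        using meas_\<beta> observable_vimage[OF obs, of "{\<pi> b}"] by auto
      also have "{x. \<beta> x = b} \<inter> {x. \<iota> x = \<pi> b} = E b" by (auto simp: E_def)
      finally show ?thesis .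
    qed
    have prob_E: "prob {x. \<beta> x = b} = prob (E b)" for b
    proof (rule finite_measure_eq_AE)
      have "AE x in \<mu>. \<pi> (\<beta> x) = \<iota> x" using ref by (simp add: refines_via_def)
      then show "AE x in \<mu>. (x \<in> {x. \<beta> x = b}) = (x \<in> E b)"
        by eventually_elim (auto simp: E_def)
    qed (use meas_\<beta> meas_E in auto)
    obtain F \<delta> L where L: "finite F" "F \<subseteq> carrier G" "0 < \<delta>" "finite L"
      and ev: "\<forall>\<^sub>F i in sequentially. \<forall>\<phi>\<in>Map_mu act \<mu> \<Delta> F \<delta> L (d i) (\<sigma> i). \<exists>\<psi>\<in>AP G act \<mu> B \<beta> F' \<xi> (d i) (\<sigma> i).
       freq (d i) {j. \<not> (\<exists>y\<in>E (\<psi> j \<one>). \<Delta> (\<phi> j) y < \<epsilon> / 8)} \<le> \<xi>"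
      using shadow_microstate[OF \<beta> F' \<xi>(1), of "\<epsilon> / 8" E] \<epsilon> meas_E prob_E by (auto simp: E_def)
    have "h_Delta_eps G d \<sigma> act \<mu> \<Delta> \<epsilon> \<le> h_Delta_loc d \<sigma> act \<mu> \<Delta> \<epsilon> F \<delta> L"
      unfolding h_Delta_eps_def using L by (intro INF_lower2[of F] INF_lower2[of \<delta>] INF_lower2[of L]) auto
    also have "\<dots> \<le> h_obs_loc G d \<sigma> act \<mu> \<pi> B \<beta> F' \<delta>'"
      unfolding h_Delta_loc_def h_obs_loc_def
    proof (rule Limsup_mono)
      show "\<forall>\<^sub>F i in sequentially.
          ereal (1 / real (d i)) * log_card (sep_number \<epsilon> (Map_mu act \<mu> \<Delta> F \<delta> L (d i) (\<sigma> i)) (Delta2 \<Delta> (d i)))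
          \<le> ereal (1 / real (d i)) * log_card (enat (card
            ((\<lambda>\<phi>. \<lambda>j\<in>{1..d i}. \<pi> (\<phi> j \<one>)) ` AP G act \<mu> B \<beta> F' \<delta>' (d i) (\<sigma> i))))"
        using ev
      proof eventually_elim
        case (elim i)
        from bchoice[OF this[unfolded Bex_def]] obtain \<Psi> where
          "\<forall>\<phi>\<in>Map_mu act \<mu> \<Delta> F \<delta> L (d i) (\<sigma> i). \<Psi> \<phi> \<in> AP G act \<mu> B \<beta> F' \<xi> (d i) (\<sigma> i) \<and>
            freq (d i) {j. \<not> (\<exists>y. y \<in> E (\<Psi> \<phi> j \<one>) \<and> \<Delta> (\<phi> j) y < \<epsilon> / 8)} \<le> \<xi>"
          by (rule exE)
        then have \<Psi>: "\<Psi> \<phi> \<in> AP G act \<mu> B \<beta> F' \<xi> (d i) (\<sigma> i)"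
          and near: "freq (d i) {j. \<not> (\<exists>y\<in>E (\<Psi> \<phi> j \<one>). \<Delta> (\<phi> j) y < \<epsilon> / 8)} \<le> \<xi>"
          if "\<phi> \<in> Map_mu act \<mu> \<Delta> F \<delta> L (d i) (\<sigma> i)" for \<phi>
          using that by (simp_all add: Bex_def)
        let ?w = "\<lambda>\<psi>. \<lambda>j\<in>{1..d i}. \<pi> (\<psi> j \<one>)"
        \<comment> \<open>The leftover index names no ball, so its occurrences are counted as
          exceptional; its \<mu>-measure is at most \<kappa>, and the microstate exceeds this by at
          most \<xi>.\<close>
        have rest: "freq (d i) {j. \<psi> j \<in> {c \<in> F' \<rightarrow>\<^sub>E B. \<pi> (c \<one>) = n}} \<le> \<kappa> + \<xi>"
          if \<psi>: "\<psi> \<in> AP G act \<mu> B \<beta> F' \<xi> (d i) (\<sigma> i)" for \<psi>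
        proof -
          have "freq (d i) {j. \<psi> j \<in> {c \<in> F' \<rightarrow>\<^sub>E B. \<pi> (c \<one>) = n}}
              \<le> prob {x. obs_itinerary G act F' \<beta> x \<in> {c \<in> F' \<rightarrow>\<^sub>E B. \<pi> (c \<one>) = n}} + \<xi>"
            by (rule AP_freq_le[OF \<psi> \<beta> F'(1,2)]) auto
          also have "prob {x. obs_itinerary G act F' \<beta> x \<in> {c \<in> F' \<rightarrow>\<^sub>E B. \<pi> (c \<one>) = n}} = prob {x. \<iota> x = n}"
          proof (rule finite_measure_eq_AE)
            have "AE x in \<mu>. \<pi> (\<beta> x) = \<iota> x" using ref by (simp add: refines_via_def)
            then show "AE x in \<mu>. (x \<in> {x. obs_itinerary G act F' \<beta> x \<in> {c \<in> F' \<rightarrow>\<^sub>E B. \<pi> (c \<one>) = n}})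
                = (x \<in> {x. \<iota> x = n})"
            proof eventually_elim
              case (elim x)
              then show ?case
                using itinerary_in[OF \<beta> F'(2), of x] F'(3) by (simp add: obs_itinerary_def)
            qed
          next
            show "{x. obs_itinerary G act F' \<beta> x \<in> {c \<in> F' \<rightarrow>\<^sub>E B. \<pi> (c \<one>) = n}} \<in> events"
              using itinerary_vimage[OF \<beta> F'(1,2)] by (simp only: sets_\<mu>)
            show "{x. \<iota> x = n} \<in> events" using observable_vimage[OF obs, of "{n}"] by simp
          qed
          finally show ?thesis using \<iota>(4) by simp
        qed
        have "sep_number \<epsilon> (Map_mu act \<mu> \<Delta> F \<delta> L (d i) (\<sigma> i)) (Delta2 \<Delta> (d i))
            \<le> enat (card (?w ` AP G act \<mu> B \<beta> F' \<delta>' (d i) (\<sigma> i)))"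
        proof (rule sep_number_le_card)
          show "finite (?w ` AP G act \<mu> B \<beta> F' \<delta>' (d i) (\<sigma> i))"
            by (intro finite_imageI finite_AP[OF \<beta> F'(1)])
          show "(\<lambda>\<phi>. ?w (\<Psi> \<phi>)) \<in> Map_mu act \<mu> \<Delta> F \<delta> L (d i) (\<sigma> i) \<rightarrow> ?w ` AP G act \<mu> B \<beta> F' \<delta>' (d i) (\<sigma> i)"
            using \<Psi> AP_mono[OF \<xi>(2)] by blast
          fix \<phi> \<phi>'
          assume \<phi>: "\<phi> \<in> Map_mu act \<mu> \<Delta> F \<delta> L (d i) (\<sigma> i)" and \<phi>': "\<phi>' \<in> Map_mu act \<mu> \<Delta> F \<delta> L (d i) (\<sigma> i)"
            and eq: "?w (\<Psi> \<phi>) = ?w (\<Psi> \<phi>')"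
          let ?S1 = "{j. \<not> (\<exists>y\<in>E (\<Psi> \<phi> j \<one>). \<Delta> (\<phi> j) y < \<epsilon> / 8)}"
          let ?S2 = "{j. \<not> (\<exists>y\<in>E (\<Psi> \<phi>' j \<one>). \<Delta> (\<phi>' j) y < \<epsilon> / 8)}"
          let ?S3 = "{j. \<Psi> \<phi> j \<in> {c \<in> F' \<rightarrow>\<^sub>E B. \<pi> (c \<one>) = n}}"
          have "freq (d i) {j. \<epsilon> / 2 < \<Delta> (\<phi> j) (\<phi>' j)} \<le> freq (d i) (?S1 \<union> (?S2 \<union> ?S3))"
          proof (rule freq_mono[OF d_pos], rule ccontr)
            fix j assume j: "j \<in> {1..d i}" "j \<in> {j. \<epsilon> / 2 < \<Delta> (\<phi> j) (\<phi>' j)}" "j \<notin> ?S1 \<union> (?S2 \<union> ?S3)"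
            obtain y y' where y: "y \<in> E (\<Psi> \<phi> j \<one>)" "\<Delta> (\<phi> j) y < \<epsilon> / 8"
              "y' \<in> E (\<Psi> \<phi>' j \<one>)" "\<Delta> (\<phi>' j) y' < \<epsilon> / 8"
              using j(3) by blast
            have "\<pi> (\<Psi> \<phi> j \<one>) = \<pi> (\<Psi> \<phi>' j \<one>)" using fun_cong[OF eq, of j] j(1) by simp
            then have \<iota>y: "\<iota> y = \<iota> y'" "\<iota> y = \<pi> (\<Psi> \<phi> j \<one>)" using y by (auto simp: E_def)
            have "\<Psi> \<phi> j \<in> F' \<rightarrow>\<^sub>E B" using \<Psi>[OF \<phi>] j(1) by (auto simp: AP_def)
            then have "\<iota> y \<noteq> n" using j(3) \<iota>y by auto
            then have "\<iota> y < n" using \<iota>(2)[of y] by simp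
            then have "\<Delta> (p (\<iota> y)) y < \<epsilon> / 8" "\<Delta> (p (\<iota> y)) y' < \<epsilon> / 8"
              using \<iota>(3)[of y] \<iota>(3)[of y'] \<iota>y(1) by auto
            \<comment> \<open>Four steps of length below \<open>\<epsilon> / 8\<close>: to the core
              point, to the common ball centre, to the other core point, to the other model.\<close>
            moreover have "\<Delta> (\<phi> j) (\<phi>' j) \<le> \<Delta> (\<phi> j) y + \<Delta> y (p (\<iota> y)) + \<Delta> (p (\<iota> y)) y' + \<Delta> y' (\<phi>' j)"
              by (intro order_trans[OF \<Delta>_tri add_right_mono] order_refl \<Delta>_tri)
            ultimately show False using y j(2) \<epsilon> by (simp add: \<Delta>_sym)
          qed
          also have "\<dots> \<le> freq (d i) ?S1 + (freq (d i) ?S2 + freq (d i) ?S3)"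
            by (intro order_trans[OF freq_Un_le] add_left_mono freq_Un_le)
          also have "\<dots> \<le> \<xi> + (\<xi> + (\<kappa> + \<xi>))"
            by (intro add_mono near[OF \<phi>] near[OF \<phi>'] rest \<Psi>[OF \<phi>])
          also have "\<dots> \<le> 4 * \<kappa>" using \<xi> by simp
          finally have "Delta2 \<Delta> (d i) \<phi> \<phi>' \<le> sqrt ((\<epsilon> / 2)\<^sup>2 + C\<^sup>2 * (4 * \<kappa>))"
            using \<epsilon> by (intro Delta2_le d_pos \<Delta>_nonneg C(2)) auto
          also have "\<dots> \<le> \<epsilon>"
            using \<epsilon> C(1) by (intro real_le_lsqrt) (auto simp: \<kappa>_def power2_eq_square field_simps)
          finally show "Delta2 \<Delta> (d i) \<phi> \<phi>' \<le> \<epsilon>" .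
        qed
        then show ?case by (intro ereal_mult_left_mono log_card_mono) auto
      qed
    qed
    finally show "h_Delta_eps G d \<sigma> act \<mu> \<Delta> \<epsilon> \<le> h_obs_loc G d \<sigma> act \<mu> \<pi> B \<beta> F' \<delta>'" .
  qed
  with obs show ?thesis by blast
qed

lemma h_Delta_le: "h_Delta G d \<sigma> act \<mu> \<Delta> \<le> sofic_measure_entropy G d \<sigma> act \<mu>"
  unfolding h_Delta_def
proof (rule SUP_least)
  fix \<epsilon> :: real assume "\<epsilon> \<in> {0<..}"
  then have "0 < \<epsilon>" by simp
  from ex_observable_h_Delta_eps_le[OF this] obtain A and \<alpha> :: "'x \<Rightarrow> nat" where \<alpha>: "observable \<mu> A \<alpha>"
    and le: "\<And>B (\<beta> :: 'x \<Rightarrow> nat) \<pi>. observable \<mu> B \<beta> \<Longrightarrow> refines_via \<mu> A \<alpha> B \<beta> \<pi> \<Longrightarrow>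
      h_Delta_eps G d \<sigma> act \<mu> \<Delta> \<epsilon> \<le> h_obs G d \<sigma> act \<mu> \<pi> B \<beta>"
    by blast
  show "h_Delta_eps G d \<sigma> act \<mu> \<Delta> \<epsilon> \<le> sofic_measure_entropy G d \<sigma> act \<mu>"
    unfolding sofic_measure_entropy_def
    using \<alpha> le by (intro SUP_upper2[of "(A, \<alpha>)"]) (auto intro!: INF_greatest)
qed

section \<open>From microstates to models\<close>

text \<open>\<beta> joins \<alpha> with membership in \<open>Q\<close> and with a partition on which
  the translates of \<Delta> along \<open>F\<close> and the functions in \<open>L\<close> vary
  little, up to small measure. One representative \<open>x\<close> per cell then realizes labels by
  points. The last estimate says that these points mostly lie in \<open>Q\<close> with the intended
  \<alpha>-label.\<close>

lemma realize_microstate: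
  fixes \<alpha> :: "'x \<Rightarrow> nat"
  assumes \<alpha>: "observable \<mu> A \<alpha>" and Q: "Q \<in> sets borel"
    and F: "finite F" "F \<subseteq> carrier G" and \<delta>: "0 < \<delta>" and L: "finite L" and \<kappa>: "0 < \<kappa>"
  obtains B and \<beta> :: "'x \<Rightarrow> nat" and \<pi> F' \<delta>' x where
    "observable \<mu> B \<beta>" "refines_via \<mu> A \<alpha> B \<beta> \<pi>" "finite F'" "F' \<subseteq> carrier G" "\<one> \<in> F'" "0 < \<delta>'"
    "\<And>n s \<psi>. 0 < n \<Longrightarrow> \<forall>g\<in>carrier G. s g permutes {1..n} \<Longrightarrow> \<psi> \<in> AP G act \<mu> B \<beta> F' \<delta>' n s \<Longrightarrow>
      (\<lambda>j\<in>{1..n}. x (\<psi> j \<one>)) \<in> Map_mu act \<mu> \<Delta> F \<delta> L n s \<and>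
      freq n {j. \<not> (x (\<psi> j \<one>) \<in> Q \<and> \<alpha> (x (\<psi> j \<one>)) = \<pi> (\<psi> j \<one>))} \<le> prob (- Q) + \<kappa>"
proof -
  obtain C where C: "0 < C" "\<And>x y. \<Delta> x y \<le> C" using \<Delta>_bound by blast
  define M where "M = 1 + (\<Sum>f\<in>L. norm f)"
  have M: "0 < M" by (simp add: M_def add_pos_nonneg sum_nonneg)
  have fM: "\<bar>f y\<bar> \<le> M" if "f \<in> L" for f :: "'x \<Rightarrow>\<^sub>C real" and y
    using norm_bounded[of f y] member_le_sum[OF that, of norm] L by (simp add: M_def)
  define F' where "F' = insert \<one> F"
  have F': "finite F'" "F' \<subseteq> carrier G" "\<one> \<in> F'" "F \<subseteq> F'" using F by (auto simp: F'_def)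
  \<comment> \<open>The count of error terms: one \<theta> for each leftover translate, one for the
    pattern statistics and one for the equivariance of the microstate.\<close>
  define m where "m = real (card F') + 2"
  have m: "0 < m" by (simp add: m_def add_nonneg_pos)
  \<comment> \<open>Equivariance errors reach \<open>4 * s0\<close>, which is
    \<open>\<delta> / 4\<close>, and oscillations of test functions reach \<open>2 * s0\<close>,
    which is \<open>\<delta> / 8\<close>.\<close>
  define s0 where "s0 = \<delta> / 16"
  have s0: "0 < s0" using \<delta> by (simp add: s0_def)
  \<comment> \<open>The three bounds serve, in order, the final frequency estimate, the exceptional
    part of \<open>Delta2\<close>, and the integrals, where \<open>3 * (M * \<theta>)\<close>
    occurs.\<close>
  define \<theta> where "\<theta> = min \<kappa> (min (\<delta>\<^sup>2 / (4 * (C\<^sup>2 * m))) (\<delta> / (8 * M)))"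
  have \<theta>: "0 < \<theta>" "\<theta> \<le> \<kappa>" using \<kappa> \<delta> C(1) M m by (auto simp: \<theta>_def)
  have "\<theta> \<le> \<delta>\<^sup>2 / (4 * (C\<^sup>2 * m))" "\<theta> \<le> \<delta> / (8 * M)" by (auto simp: \<theta>_def)
  then have \<theta>C: "C\<^sup>2 * (m * \<theta>) \<le> \<delta>\<^sup>2 / 4" and \<theta>M: "M * \<theta> \<le> \<delta> / 8"
    using C(1) m M by (simp_all add: field_simps)
  define U where "U = (\<lambda>p. {y. near F' s0 p y} \<inter> (\<Inter>f\<in>L. {y. \<bar>apply_bcontfun f p - apply_bcontfun f y\<bar> < s0}))"
  have opn: "open (U p)" for p
  proof -
    have "open {y. \<bar>apply_bcontfun f p - apply_bcontfun f y\<bar> < s0}" for f :: "'x \<Rightarrow>\<^sub>C real"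
      by (intro open_Collect_less continuous_intros continuous_on_apply_bcontfun)
    moreover have "open {y. near F' s0 p y}"
      using open_near[OF F'(1,2), of s0 p] by (simp add: near_sym)
    ultimately show ?thesis unfolding U_def using L by (intro open_Int open_INT) auto
  qed
  have mem: "p \<in> U p" for p using s0 by (auto simp: U_def near_def)
  obtain k p \<iota> where \<iota>: "\<iota> \<in> \<mu> \<rightarrow>\<^sub>M count_space (UNIV :: nat set)" "\<And>x. \<iota> x \<le> k"
    "\<And>x. \<iota> x < k \<Longrightarrow> x \<in> U (p (\<iota> x))" "prob {x. \<iota> x = k} \<le> \<theta>"
    by (rule neighbourhood_index[OF opn mem \<theta>(1)]) (rule that)
  have \<iota>_meas: "{x. \<iota> x = i} \<in> sets borel" for i
    using measurable_sets[OF \<iota>(1), of "{i}"] by (simp add: vimage_def)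
  \<comment> \<open>Since membership in \<open>Q\<close> is part of the label, every cell lies
    inside \<open>Q\<close> or outside it, and its representative does likewise.\<close>
  define \<beta> :: "'x \<Rightarrow> nat" where "\<beta> = (\<lambda>y. to_nat (\<iota> y, \<alpha> y, y \<in> Q))"
  define B :: "nat set" where "B = to_nat ` ({..k} \<times> A \<times> (UNIV :: bool set))"
  define \<pi> :: "nat \<Rightarrow> nat" where "\<pi> = (\<lambda>b. fst (snd (from_nat b :: nat \<times> nat \<times> bool)))"
  have \<pi>\<beta>: "\<pi> (\<beta> y) = \<alpha> y" for y by (simp add: \<pi>_def \<beta>_def)
  have \<beta>_eq: "\<beta> y = \<beta> z \<longleftrightarrow> \<iota> y = \<iota> z \<and> \<alpha> y = \<alpha> z \<and> (y \<in> Q \<longleftrightarrow> z \<in> Q)" for y z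
    by (auto simp: \<beta>_def)
  have finB: "finite B" using \<alpha> by (simp add: B_def observable_def)
  have \<beta>: "observable \<mu> B \<beta>"
    unfolding observable_def
  proof (intro conjI finB, subst measurable_count_space_eq2[OF finB], intro conjI ballI)
    show "\<beta> \<in> space \<mu> \<rightarrow> B" using \<iota>(2) observable_in[OF \<alpha>] by (auto simp: \<beta>_def B_def)
    fix b assume "b \<in> B"
    then obtain t :: "nat \<times> nat \<times> bool" where "b = to_nat t" unfolding B_def by blast
    then obtain i a q where b: "b = to_nat (i :: nat, a :: nat, q :: bool)" by (cases t) auto
    have "{y. \<iota> y = i} \<inter> {y. \<alpha> y = a} \<inter> (if q then Q else - Q) \<in> sets borel"
      using \<iota>_meas observable_vimage[OF \<alpha>, of "{a}"] Q by (auto intro: borel_comp)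
    also have "{y. \<iota> y = i} \<inter> {y. \<alpha> y = a} \<inter> (if q then Q else - Q) = \<beta> -` {b} \<inter> space \<mu>"
      by (auto simp: \<beta>_def b)
    finally show "\<beta> -` {b} \<inter> space \<mu> \<in> sets \<mu>" by simp
  qed
  have ref: "refines_via \<mu> A \<alpha> B \<beta> \<pi>"
    unfolding refines_via_def using \<pi>\<beta> by (auto simp: B_def \<pi>_def)
  \<comment> \<open>For a label that never occurs the value is arbitrary; a pattern with such a
    label at the identity is no itinerary and falls into \<open>?bad\<close>.\<close>
  define x where "x b = (SOME y. \<beta> y = b)" for b
  have "\<beta> (x (\<beta> y)) = \<beta> y" for y unfolding x_def by (rule someI) simp
  then have x: "\<iota> (x (\<beta> y)) = \<iota> y" "\<alpha> (x (\<beta> y)) = \<alpha> y" "x (\<beta> y) \<in> Q \<longleftrightarrow> y \<in> Q" for y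
    using \<beta>_eq by blast+
  have near_x: "near F' (2 * s0) (x (\<beta> y)) y" if "\<iota> y < k" for y
  proof -
    have "near F' s0 (p (\<iota> y)) y" "near F' s0 (p (\<iota> y)) (x (\<beta> y))"
      using \<iota>(3)[of y] \<iota>(3)[of "x (\<beta> y)"] that x(1)[of y] by (auto simp: U_def)
    then have "near F' (s0 + s0) (x (\<beta> y)) y" using near_tri near_sym by blast
    then show ?thesis by simp
  qed
  have f_x: "\<bar>f (x (\<beta> y)) - f y\<bar> < 2 * s0" if "\<iota> y < k" "f \<in> L" for y and f :: "'x \<Rightarrow>\<^sub>C real"
  proof -
    have "\<bar>f (p (\<iota> y)) - f y\<bar> < s0" "\<bar>f (p (\<iota> y)) - f (x (\<beta> y))\<bar> < s0"
      using \<iota>(3)[of y] \<iota>(3)[of "x (\<beta> y)"] that x(1)[of y] by (auto simp: U_def)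
    then show ?thesis by linarith
  qed
  let ?I = "F' \<rightarrow>\<^sub>E B"
  have finI: "finite ?I" using F' finB by (intro finite_PiE) auto
  let ?bad = "{c \<in> ?I. \<not> (\<exists>y. obs_itinerary G act F' \<beta> y = c \<and> (\<forall>g\<in>F'. \<iota> (act (inv g) y) < k))}"
  have prob_bad: "prob {y. obs_itinerary G act F' \<beta> y \<in> ?bad} \<le> real (card F') * \<theta>"
  proof -
    have "{y. obs_itinerary G act F' \<beta> y \<in> ?bad} \<subseteq> (\<Union>g\<in>F'. {y. act (inv g) y \<in> {z. \<iota> z = k}})"
    proof
      fix y assume "y \<in> {y. obs_itinerary G act F' \<beta> y \<in> ?bad}"
      then obtain g where "g \<in> F'" "\<not> \<iota> (act (inv g) y) < k" by blast
      moreover have "\<iota> (act (inv g) y) \<le> k" by (rule \<iota>(2))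
      ultimately show "y \<in> (\<Union>g\<in>F'. {y. act (inv g) y \<in> {z. \<iota> z = k}})" by auto
    qed
    moreover have meas: "{y. act (inv g) y \<in> {z. \<iota> z = k}} \<in> sets \<mu>" if "g \<in> F'" for g
      using measurable_sets[OF measurable_act \<iota>_meas, of "inv g" k] that F'(2) by (auto simp: vimage_def)
    ultimately have "prob {y. obs_itinerary G act F' \<beta> y \<in> ?bad}
        \<le> prob (\<Union>g\<in>F'. {y. act (inv g) y \<in> {z. \<iota> z = k}})"
      using F'(1) by (intro finite_measure_mono sets.finite_UN)
    also have "\<dots> \<le> (\<Sum>g\<in>F'. prob {y. act (inv g) y \<in> {z. \<iota> z = k}})"
      using F'(1) meas by (rule measure_UNION_le)
    also have "\<dots> \<le> (\<Sum>g\<in>F'. \<theta>)"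
    proof (rule sum_mono)
      fix g assume "g \<in> F'"
      then have "prob {y. act (inv g) y \<in> {z. \<iota> z = k}} = prob {z. \<iota> z = k}"
        using F'(2) \<iota>_meas by (intro prob_act) auto
      then show "prob {y. act (inv g) y \<in> {z. \<iota> z = k}} \<le> \<theta>" using \<iota>(4) by simp
    qed
    finally show ?thesis by simp
  qed
  show ?thesis
  proof (rule that[OF \<beta> ref F'(1,2,3) \<theta>(1)], intro conjI)
    fix n s \<psi>
    assume n: "0 < n" and s: "\<forall>g\<in>carrier G. s g permutes {1..n}" and \<psi>: "\<psi> \<in> AP G act \<mu> B \<beta> F' \<theta> n s"
    have \<psi>_I: "\<psi> j \<in> ?I" if "j \<in> {1..n}" for j using \<psi> that by (auto simp: AP_def)
    define \<phi> where "\<phi> = (\<lambda>j\<in>{1..n}. x (\<psi> j \<one>))"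
    have freq_bad: "freq n {j. \<psi> j \<in> ?bad} \<le> real (card F') * \<theta> + \<theta>"
      using AP_freq_le[OF \<psi> \<beta> F'(1,2), of ?bad] prob_bad by force
    have "Delta2 \<Delta> n (\<phi> \<circ> s g) (act g \<circ> \<phi>) < \<delta>" if g: "g \<in> F" for g
    proof -
      have gG: "g \<in> carrier G" and gF': "g \<in> F'" using g F F' by auto
      have sg: "s g permutes {1..n}" using s gG by blast
      \<comment> \<open>A good pattern at \<open>s g j\<close> is the itinerary of a true point
        \<open>y\<close>. Its label at the identity puts \<open>\<phi> (s g j)\<close> near
        \<open>y\<close>, and its label at \<open>g\<close> is that of index \<open>j\<close>, which
        puts \<open>act g (\<phi> j)\<close> near \<open>act g (act (inv g) y)\<close>, again
        \<open>y\<close>.\<close>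
      have "freq n {j. 4 * s0 < \<Delta> ((\<phi> \<circ> s g) j) ((act g \<circ> \<phi>) j)}
          \<le> freq n ({j. \<psi> (s g j) \<in> ?bad} \<union> {j. \<psi> (s g j) g \<noteq> \<psi> (inv_into UNIV (s g) (s g j)) \<one>})"
      proof (rule freq_mono[OF n], rule ccontr)
        fix j assume j: "j \<in> {1..n}" "j \<in> {j. 4 * s0 < \<Delta> ((\<phi> \<circ> s g) j) ((act g \<circ> \<phi>) j)}"
          and "j \<notin> {j. \<psi> (s g j) \<in> ?bad} \<union> {j. \<psi> (s g j) g \<noteq> \<psi> (inv_into UNIV (s g) (s g j)) \<one>}"
        then have nb: "\<psi> (s g j) \<notin> ?bad" and eq: "\<psi> (s g j) g = \<psi> j \<one>"
          using permutes_inverses(2)[OF sg] by auto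
        have sj: "s g j \<in> {1..n}" using permutes_in_image[OF sg] j(1) by blast
        then obtain y where y: "obs_itinerary G act F' \<beta> y = \<psi> (s g j)" "\<forall>g\<in>F'. \<iota> (act (inv g) y) < k"
          using nb \<psi>_I[OF sj] by blast
        have it: "\<psi> (s g j) h = \<beta> (act (inv h) y)" if "h \<in> F'" for h
          using that by (simp add: obs_itinerary_def flip: y(1))
        have "\<phi> (s g j) = x (\<beta> y)" using it[OF F'(3)] sj by (simp add: \<phi>_def)
        moreover have "\<phi> j = x (\<beta> (act (inv g) y))" using it[OF gF'] eq j(1) by (simp add: \<phi>_def)
        moreover have "\<Delta> (x (\<beta> y)) y < 2 * s0"
          using near_x[of y] y(2) F'(3) unfolding near_def by fastforce
        moreover have "\<Delta> (act g (x (\<beta> (act (inv g) y)))) y < 2 * s0"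
          using near_x[of "act (inv g) y"] y(2) gF' act_inv[OF gG] unfolding near_def by fastforce
        ultimately have "\<Delta> (\<phi> (s g j)) (act g (\<phi> j)) < 4 * s0"
          using \<Delta>_tri[of "\<phi> (s g j)" "act g (\<phi> j)" y] by (simp add: \<Delta>_sym)
        then show False using j(2) by simp
      qed
      also have "\<dots> \<le> freq n {j. \<psi> (s g j) \<in> ?bad}
          + freq n {j. \<psi> (s g j) g \<noteq> \<psi> (inv_into UNIV (s g) (s g j)) \<one>}"
        by (rule freq_Un_le)
      also have "freq n {j. \<psi> (s g j) \<in> ?bad} = freq n {j. \<psi> j \<in> ?bad}"
        by (rule freq_permutes[OF n sg])
      also have "freq n {j. \<psi> (s g j) g \<noteq> \<psi> (inv_into UNIV (s g) (s g j)) \<one>}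
          = freq n {j. \<psi> j g \<noteq> \<psi> (inv_into UNIV (s g) j) \<one>}"
        by (rule freq_permutes[OF n sg])
      also have "freq n {j. \<psi> j \<in> ?bad} + freq n {j. \<psi> j g \<noteq> \<psi> (inv_into UNIV (s g) j) \<one>}
          \<le> (real (card F') * \<theta> + \<theta>) + \<theta>"
        using \<psi> gF' by (intro add_mono freq_bad) (auto simp: AP_def intro: less_imp_le)
      also have "\<dots> = m * \<theta>" by (simp add: m_def algebra_simps)
      finally have "Delta2 \<Delta> n (\<phi> \<circ> s g) (act g \<circ> \<phi>) \<le> sqrt ((4 * s0)\<^sup>2 + C\<^sup>2 * (m * \<theta>))"
        using s0 by (intro Delta2_le n \<Delta>_nonneg C(2)) auto
      also have "\<dots> \<le> sqrt (\<delta>\<^sup>2 / 16 + \<delta>\<^sup>2 / 4)"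
        using \<theta>C by (intro real_sqrt_le_mono add_mono) (simp_all add: s0_def power_divide)
      also have "\<dots> < \<delta>" using \<delta> by (intro real_less_lsqrt) (simp_all add: field_simps)
      finally show ?thesis .
    qed
    moreover have "\<bar>measure_pmf.expectation (map_pmf \<phi> (unif n)) f - expectation f\<bar> < \<delta>"
      if f: "f \<in> L" for f :: "'x \<Rightarrow>\<^sub>C real"
    proof -
      have f_meas: "apply_bcontfun f \<in> borel_measurable \<mu>"
        using borel_measurable_continuous_onI[OF continuous_on_apply_bcontfun, of f] by simp
      have \<beta>_meas: "\<beta> \<in> \<mu> \<rightarrow>\<^sub>M count_space UNIV"
        using observable_vimage[OF \<beta>] by (intro measurableI) (auto simp: vimage_def)
      have fx_meas: "(\<lambda>y. f (x (\<beta> y))) \<in> borel_measurable \<mu>"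
        by (rule measurable_compose[OF \<beta>_meas]) simp
      have int_f: "integrable \<mu> (apply_bcontfun f)" and int_fx: "integrable \<mu> (\<lambda>y. f (x (\<beta> y)))"
        using fM[OF f] f_meas fx_meas by (auto intro!: integrable_const_bound[of _ M])
      have int_k: "integrable \<mu> (indicat_real {y. \<iota> y = k})"
        using \<iota>_meas by (intro integrable_real_indicator) (auto simp: emeasure_eq_measure)
      then have int_ind: "integrable \<mu> (\<lambda>y. 2 * s0 + 2 * M * indicator {y. \<iota> y = k} y)"
        by (intro Bochner_Integration.integrable_add integrable_const integrable_mult_right)
      \<comment> \<open>Replacing points by representatives changes \<open>f\<close> by less than
        \<open>2 * s0\<close>, except on the leftover cell, where the change is at most
        \<open>2 * M\<close>.\<close>
      have "\<bar>expectation (\<lambda>y. f (x (\<beta> y))) - expectation f\<bar> = \<bar>expectation (\<lambda>y. f (x (\<beta> y)) - f y)\<bar>"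
        using int_f int_fx by simp
      also have "\<dots> \<le> expectation (\<lambda>y. \<bar>f (x (\<beta> y)) - f y\<bar>)"
        by (rule integral_abs_bound)
      also have "\<dots> \<le> expectation (\<lambda>y. 2 * s0 + 2 * M * indicator {y. \<iota> y = k} y)"
      proof (intro integral_mono int_ind integrable_abs Bochner_Integration.integrable_diff int_f int_fx)
        fix y show "\<bar>f (x (\<beta> y)) - f y\<bar> \<le> 2 * s0 + 2 * M * indicator {y. \<iota> y = k} y"
        proof (cases "\<iota> y < k")
          case True then show ?thesis using f_x[OF True f] by simp
        next
          case False
          then have "\<iota> y = k" using \<iota>(2)[of y] by simp
          then show ?thesis using fM[OF f, of y] fM[OF f, of "x (\<beta> y)"] s0 by simp
        qed
      qed
      also have "\<dots> = 2 * s0 + 2 * M * prob {y. \<iota> y = k}"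
        using \<iota>_meas prob_space int_k by (subst Bochner_Integration.integral_add) auto
      also have "\<dots> \<le> 2 * s0 + 2 * (M * \<theta>)" using \<iota>(4) M by simp
      finally have T1: "\<bar>expectation (\<lambda>y. f (x (\<beta> y))) - expectation f\<bar> \<le> 2 * s0 + 2 * (M * \<theta>)" .
      let ?q = "\<lambda>c. prob (obs_itinerary G act F' \<beta> -` {c} \<inter> space \<mu>)"
      have "expectation (\<lambda>y. f (x (\<beta> y))) = expectation (\<lambda>y. f (x (obs_itinerary G act F' \<beta> y \<one>)))"
        using F'(3) by (simp add: obs_itinerary_def)
      also have "\<dots> = (\<Sum>c\<in>?I. ?q c * f (x (c \<one>)))"
      proof (rule expectation_finite_range[OF finI, where h="\<lambda>c. f (x (c \<one>))"])
        show "AE y in \<mu>. obs_itinerary G act F' \<beta> y \<in> ?I" using itinerary_in[OF \<beta> F'(2)] by simp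
        show "(\<lambda>y. f (x (obs_itinerary G act F' \<beta> y \<one>))) \<in> borel_measurable \<mu>"
          using fx_meas F'(3) by (simp add: obs_itinerary_def)
        show "obs_itinerary G act F' \<beta> -` {c} \<inter> space \<mu> \<in> events" for c
          using itinerary_vimage[OF \<beta> F'(1,2), of "{c}"] by (simp add: vimage_def)
      qed
      finally have T2: "expectation (\<lambda>y. f (x (\<beta> y))) = (\<Sum>c\<in>?I. ?q c * f (x (c \<one>)))" .
      have "measure_pmf.expectation (map_pmf \<phi> (unif n)) f = measure_pmf.expectation (unif n) (\<lambda>j. f (x (\<psi> j \<one>)))"
        using n by (simp add: expectation_unif \<phi>_def)
      also have "\<dots> = (\<Sum>c\<in>?I. freq n (\<psi> -` {c} \<inter> space (measure_pmf (unif n))) * f (x (c \<one>)))"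
        using \<psi>_I n by (intro measure_pmf.expectation_finite_range[OF finI, where h="\<lambda>c. f (x (c \<one>))"])
          (auto simp: AE_measure_pmf_iff set_pmf_unif)
      finally have T3: "measure_pmf.expectation (map_pmf \<phi> (unif n)) f = (\<Sum>c\<in>?I. freq n (\<psi> -` {c}) * f (x (c \<one>)))"
        by simp
      \<comment> \<open>Both integrals are now sums of the same values over patterns, and the
        weights differ in total by less than \<theta>.\<close>
      have "\<bar>measure_pmf.expectation (map_pmf \<phi> (unif n)) f - expectation (\<lambda>y. f (x (\<beta> y)))\<bar>
          = \<bar>\<Sum>c\<in>?I. (freq n (\<psi> -` {c}) - ?q c) * f (x (c \<one>))\<bar>"
        unfolding T2 T3 by (simp add: sum_subtractf left_diff_distrib)
      also have "\<dots> \<le> (\<Sum>c\<in>?I. \<bar>freq n (\<psi> -` {c}) - ?q c\<bar> * M)"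
        using fM[OF f] by (intro order_trans[OF sum_abs] sum_mono) (simp add: abs_mult mult_left_mono)
      also have "\<dots> = (\<Sum>c\<in>?I. \<bar>freq n (\<psi> -` {c}) - ?q c\<bar>) * M" by (rule sum_distrib_right[symmetric])
      also have "\<dots> \<le> \<theta> * M"
        using \<psi> M by (intro mult_right_mono) (auto simp: AP_def intro: less_imp_le)
      finally have "\<bar>measure_pmf.expectation (map_pmf \<phi> (unif n)) f - expectation (\<lambda>y. f (x (\<beta> y)))\<bar> \<le> M * \<theta>"
        by (simp add: mult.commute)
      then have "\<bar>measure_pmf.expectation (map_pmf \<phi> (unif n)) f - expectation f\<bar> \<le> 2 * s0 + 3 * (M * \<theta>)"
        using T1 by linarith
      also have "\<dots> < \<delta>" using \<theta>M \<delta> by (simp add: s0_def)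
      finally show ?thesis .
    qed
    ultimately show "\<phi> \<in> Map_mu act \<mu> \<Delta> F \<delta> L n s" by (auto simp: Map_mu_def \<phi>_def)
    \<comment> \<open>If the label at the identity is attained on \<open>Q\<close>, its
      representative lies in \<open>Q\<close> and has \<alpha>-label given by \<pi>; so only
      patterns in \<open>?S\<close> can fail.\<close>
    let ?S = "{c \<in> ?I. c \<one> \<notin> \<beta> ` Q}"
    have "freq n {j. \<not> (x (\<psi> j \<one>) \<in> Q \<and> \<alpha> (x (\<psi> j \<one>)) = \<pi> (\<psi> j \<one>))} \<le> freq n {j. \<psi> j \<in> ?S}"
      using \<psi>_I x \<pi>\<beta> by (intro freq_mono n) auto
    also have "\<dots> \<le> prob {y. obs_itinerary G act F' \<beta> y \<in> ?S} + \<theta>"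
      by (rule AP_freq_le[OF \<psi> \<beta> F'(1,2)]) auto
    also have "prob {y. obs_itinerary G act F' \<beta> y \<in> ?S} \<le> prob (- Q)"
      using Q F'(3) by (intro finite_measure_mono) (auto simp: obs_itinerary_def intro: borel_comp)
    finally show "freq n {j. \<not> (x (\<psi> j \<one>) \<in> Q \<and> \<alpha> (x (\<psi> j \<one>)) = \<pi> (\<psi> j \<one>))} \<le> prob (- Q) + \<kappa>"
      using \<theta>(2) by simp
  qed
qed

text \<open>\<epsilon> is fixed from \<alpha> and \<eta> before \<open>F\<close>, \<delta> and
  \<open>L\<close>, whereas \<beta> may depend on all of them. Words are mapped to models; models
  that are \<epsilon>-close come from words in one Hamming ball, whose size costs only the rate
  \<eta>.\<close>

lemma ex_eps_h_obs_le:
  fixes \<alpha> :: "'x \<Rightarrow> nat"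
  assumes \<alpha>: "observable \<mu> A \<alpha>" and \<eta>: "0 < \<eta>"
  shows "\<exists>\<epsilon>>0. \<forall>F \<delta> L. finite F \<longrightarrow> F \<subseteq> carrier G \<longrightarrow> 0 < \<delta> \<longrightarrow> finite L \<longrightarrow>
    (\<exists>B (\<beta> :: 'x \<Rightarrow> nat) \<pi>. observable \<mu> B \<beta> \<and> refines_via \<mu> A \<alpha> B \<beta> \<pi> \<and>
      h_obs G d \<sigma> act \<mu> \<pi> B \<beta> \<le> ereal \<eta> + h_Delta_loc d \<sigma> act \<mu> \<Delta> \<epsilon> F \<delta> L)"
proof -
  have A: "finite A" using \<alpha> by (simp add: observable_def)
  obtain \<kappa> where \<kappa>: "0 < \<kappa>" and ball: "\<And>d w0. 0 < d \<Longrightarrow>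
      real (card {w \<in> {1..d} \<rightarrow>\<^sub>E A. freq d {j. w j \<noteq> w0 j} \<le> \<kappa>}) \<le> exp (\<eta> * real d)"
    using card_Hamming_ball[OF A \<eta>] by blast
  have meas_\<alpha>: "{x. \<alpha> x = a} \<in> sets borel" for a
    using observable_vimage[OF \<alpha>, of "{a}"] by simp
  have disj: "disjoint_family_on (\<lambda>a. {x. \<alpha> x = a}) A" by (auto simp: disjoint_family_on_def)
  have \<kappa>A: "0 < \<kappa> / (8 * (real (card A) + 1))" using \<kappa> by (simp add: add_nonneg_pos)
  obtain K F0 r where K: "\<And>a. a \<in> A \<Longrightarrow> compact (K a)" "\<And>a. a \<in> A \<Longrightarrow> K a \<subseteq> {x. \<alpha> x = a}"
      "\<And>a. a \<in> A \<Longrightarrow> prob {x. \<alpha> x = a} \<le> prob (K a) + \<kappa> / (8 * (real (card A) + 1))"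
    and F0: "finite F0" "F0 \<subseteq> carrier G" and r: "0 < r"
    and sep: "\<And>a a' x y. a \<in> A \<Longrightarrow> a' \<in> A \<Longrightarrow> a \<noteq> a' \<Longrightarrow> x \<in> K a \<Longrightarrow> y \<in> K a' \<Longrightarrow> \<not> near F0 r x y"
    by (rule separated_cores[OF A meas_\<alpha> disj \<kappa>A]) (rule that)
  define Q where "Q = (\<Union>a\<in>A. K a)"
  have K_meas: "K a \<in> sets borel" if "a \<in> A" for a using K(1)[OF that] by (rule borel_compact)
  have Q: "Q \<in> sets borel" unfolding Q_def using A K_meas by (intro sets.finite_UN) auto
  have "prob (- Q) \<le> prob (\<Union>a\<in>A. {x. \<alpha> x = a} - K a)"
  proof (rule finite_measure_mono)
    show "- Q \<subseteq> (\<Union>a\<in>A. {x. \<alpha> x = a} - K a)"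
      using observable_in[OF \<alpha>] unfolding Q_def by blast
    show "(\<Union>a\<in>A. {x. \<alpha> x = a} - K a) \<in> events"
      using A K_meas meas_\<alpha> by (intro sets.finite_UN sets.Diff) auto
  qed
  also have "\<dots> \<le> (\<Sum>a\<in>A. prob ({x. \<alpha> x = a} - K a))"
    using A K_meas meas_\<alpha> by (intro measure_UNION_le) auto
  also have "\<dots> \<le> (\<Sum>a\<in>A. \<kappa> / (8 * (real (card A) + 1)))"
  proof (rule sum_mono)
    fix a assume a: "a \<in> A"
    have "prob ({x. \<alpha> x = a} - K a) = prob {x. \<alpha> x = a} - prob (K a)"
      using K(2)[OF a] K_meas[OF a] meas_\<alpha> by (intro finite_measure_Diff) auto
    then show "prob ({x. \<alpha> x = a} - K a) \<le> \<kappa> / (8 * (real (card A) + 1))"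
      using K(3)[OF a] by simp
  qed
  also have "\<dots> \<le> \<kappa> / 8" using \<kappa> by (simp add: field_simps add_pos_nonneg)
  finally have prob_Q: "prob (- Q) \<le> \<kappa> / 8" .
  \<comment> \<open>A third of the separation radius, for a chain of three distances.\<close>
  define s where "s = r / 3"
  have s: "0 < s" using r by (simp add: s_def)
  \<comment> \<open>For each \<open>f\<close> in \<open>F0\<close> three Chebyshev terms
    \<open>\<epsilon>\<^sup>2 / s\<^sup>2\<close> will occur; with this choice they total at most
    \<open>\<kappa> / 4\<close>.\<close>
  define \<epsilon> where "\<epsilon> = s * sqrt (\<kappa> / (16 * (real (card F0) + 1)))"
  have m0: "0 < 16 * (real (card F0) + 1)" by (simp add: add_nonneg_pos)
  have \<epsilon>: "0 < \<epsilon>" using s \<kappa> m0 unfolding \<epsilon>_def by (intro mult_pos_pos) auto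
  have "\<epsilon>\<^sup>2 / s\<^sup>2 = \<kappa> / (16 * (real (card F0) + 1))"
    using s \<kappa> m0 by (simp add: \<epsilon>_def power_mult_distrib)
  then have "real (card F0) * (3 * (\<epsilon>\<^sup>2 / s\<^sup>2)) = 3 * real (card F0) / (16 * (real (card F0) + 1)) * \<kappa>"
    by (simp only: times_divide_eq_left times_divide_eq_right mult_ac)
  also have "\<dots> \<le> 1 / 4 * \<kappa>"
    using \<kappa> by (intro mult_right_mono) (auto simp: field_simps)
  finally have \<epsilon>s: "real (card F0) * (3 * (\<epsilon>\<^sup>2 / s\<^sup>2)) \<le> \<kappa> / 4" by simp
  have "\<exists>B (\<beta> :: 'x \<Rightarrow> nat) \<pi>. observable \<mu> B \<beta> \<and> refines_via \<mu> A \<alpha> B \<beta> \<pi> \<and>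
      h_obs G d \<sigma> act \<mu> \<pi> B \<beta> \<le> ereal \<eta> + h_Delta_loc d \<sigma> act \<mu> \<Delta> \<epsilon> F \<delta> L"
    if F: "finite F" "F \<subseteq> carrier G" and \<delta>: "0 < \<delta>" and L: "finite L" for F \<delta> L
  proof -
    \<comment> \<open>The models are also made equivariant along \<open>F0\<close> with defect below
      \<epsilon>, so that closeness of models passes to translates; monotonicity of
      \<open>Map_mu\<close> then returns to \<open>F\<close> and \<delta>.\<close>
    have F1: "finite (F \<union> F0)" "F \<union> F0 \<subseteq> carrier G" and \<delta>1: "0 < min \<delta> \<epsilon>" and \<kappa>8: "0 < \<kappa> / 8"
      using F F0 \<delta> \<epsilon> \<kappa> by auto
    obtain B and \<beta> :: "'x \<Rightarrow> nat" and \<pi> F' \<delta>' x where \<beta>: "observable \<mu> B \<beta>" and ref: "refines_via \<mu> A \<alpha> B \<beta> \<pi>"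
      and F': "finite F'" "F' \<subseteq> carrier G" "\<one> \<in> F'" and \<delta>': "0 < \<delta>'"
      and model: "\<And>n s \<psi>. 0 < n \<Longrightarrow> \<forall>g\<in>carrier G. s g permutes {1..n} \<Longrightarrow> \<psi> \<in> AP G act \<mu> B \<beta> F' \<delta>' n s \<Longrightarrow>
        (\<lambda>j\<in>{1..n}. x (\<psi> j \<one>)) \<in> Map_mu act \<mu> \<Delta> (F \<union> F0) (min \<delta> \<epsilon>) L n s \<and>
        freq n {j. \<not> (x (\<psi> j \<one>) \<in> Q \<and> \<alpha> (x (\<psi> j \<one>)) = \<pi> (\<psi> j \<one>))} \<le> prob (- Q) + \<kappa> / 8"
      by (rule realize_microstate[OF \<alpha> Q F1 \<delta>1 L \<kappa>8]) (rule that)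
    have \<pi>: "\<pi> \<in> B \<rightarrow> A" using ref by (simp add: refines_via_def)
    have bound: "log_card (enat (card ((\<lambda>\<psi>. \<lambda>j\<in>{1..d i}. \<pi> (\<psi> j \<one>)) ` AP G act \<mu> B \<beta> F' \<delta>' (d i) (\<sigma> i))))
        \<le> ereal (\<eta> * real (d i)) + log_card (sep_number \<epsilon> (Map_mu act \<mu> \<Delta> F \<delta> L (d i) (\<sigma> i)) (Delta2 \<Delta> (d i)))" for i
    proof -
      let ?AP = "AP G act \<mu> B \<beta> F' \<delta>' (d i) (\<sigma> i)"
      let ?w = "\<lambda>\<psi>. \<lambda>j\<in>{1..d i}. \<pi> (\<psi> j \<one>)"
      let ?W = "?w ` ?AP"
      have W: "finite ?W" by (intro finite_imageI finite_AP[OF \<beta> F'(1)])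
      \<comment> \<open>One microstate is chosen for each word, since words rather than microstates
        are counted.\<close>
      define \<Psi> where "\<Psi> = inv_into ?AP ?w"
      have \<Psi>: "\<Psi> w \<in> ?AP" "?w (\<Psi> w) = w" if "w \<in> ?W" for w
        using that unfolding \<Psi>_def by (rule inv_into_into, rule f_inv_into_f)
      define \<Phi> where "\<Phi> w = (\<lambda>j\<in>{1..d i}. x (\<Psi> w j \<one>))" for w
      have perm: "\<forall>g\<in>carrier G. \<sigma> i g permutes {1..d i}" using permutes_\<sigma> by blast
      have \<Phi>: "\<Phi> w \<in> Map_mu act \<mu> \<Delta> (F \<union> F0) (min \<delta> \<epsilon>) L (d i) (\<sigma> i)"
        "freq (d i) {j. \<not> (x (\<Psi> w j \<one>) \<in> Q \<and> \<alpha> (x (\<Psi> w j \<one>)) = \<pi> (\<Psi> w j \<one>))} \<le> \<kappa> / 4"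
        if "w \<in> ?W" for w
        using model[OF d_pos perm \<Psi>(1)[OF that]] prob_Q by (auto simp: \<Phi>_def)
      have \<Phi>_Map: "\<Phi> w \<in> Map_mu act \<mu> \<Delta> F \<delta> L (d i) (\<sigma> i)" if "w \<in> ?W" for w
        using \<Phi>(1)[OF that] Map_mu_mono[of F "F \<union> F0" "min \<delta> \<epsilon>" \<delta> L L] by auto
      have W_PiE: "w \<in> {1..d i} \<rightarrow>\<^sub>E A" if "w \<in> ?W" for w
      proof -
        obtain \<psi> where \<psi>: "\<psi> \<in> ?AP" "w = ?w \<psi>" using \<open>w \<in> ?W\<close> by blast
        have "\<psi> j \<one> \<in> B" if "j \<in> {1..d i}" for j
          using \<psi>(1) that F'(3) unfolding AP_def by blast
        then show ?thesis using \<pi> unfolding \<psi>(2) by (intro restrict_PiE_iff[THEN iffD2]) blast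
      qed
      obtain V where V: "V \<subseteq> ?W"
        "\<And>v w. v \<in> V \<Longrightarrow> w \<in> V \<Longrightarrow> v \<noteq> w \<Longrightarrow> \<epsilon> < Delta2 \<Delta> (d i) (\<Phi> v) (\<Phi> w)"
        "\<And>w. w \<in> ?W \<Longrightarrow> \<exists>v\<in>V. Delta2 \<Delta> (d i) (\<Phi> v) (\<Phi> w) \<le> \<epsilon>"
      proof (rule maximal_separated_subset[OF W, of "\<lambda>v w. Delta2 \<Delta> (d i) (\<Phi> v) (\<Phi> w)" \<epsilon>])
        show "Delta2 \<Delta> (d i) (\<Phi> w) (\<Phi> w) \<le> \<epsilon>" for w using \<epsilon> by (simp add: Delta2_refl)
        show "Delta2 \<Delta> (d i) (\<Phi> v) (\<Phi> w) = Delta2 \<Delta> (d i) (\<Phi> w) (\<Phi> v)" for v w by (rule Delta2_sym)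
      qed (rule that)
      have finV: "finite V" using V(1) W by (rule finite_subset)
      have inj: "inj_on \<Phi> V"
        using V(2) \<epsilon> by (intro inj_onI) (metis Delta2_refl less_asym)
      have "enat (card V) = enat (card (\<Phi> ` V))" using inj by (simp add: card_image)
      also have "\<dots> \<le> sep_number \<epsilon> (Map_mu act \<mu> \<Delta> F \<delta> L (d i) (\<sigma> i)) (Delta2 \<Delta> (d i))"
      proof (rule card_le_sep_number)
        show "finite (\<Phi> ` V)" using finV by simp
        show "\<Phi> ` V \<subseteq> Map_mu act \<mu> \<Delta> F \<delta> L (d i) (\<sigma> i)" using \<Phi>_Map V(1) by auto
        show "\<epsilon> < Delta2 \<Delta> (d i) \<phi> \<phi>'" if "\<phi> \<in> \<Phi> ` V" "\<phi>' \<in> \<Phi> ` V" "\<phi> \<noteq> \<phi>'" for \<phi> \<phi>'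
          using that V(2) by auto
      qed
      finally have cardV: "enat (card V) \<le> sep_number \<epsilon> (Map_mu act \<mu> \<Delta> F \<delta> L (d i) (\<sigma> i)) (Delta2 \<Delta> (d i))" .
      have Hamming: "freq (d i) {j. w j \<noteq> v j} \<le> \<kappa>"
        if w: "w \<in> ?W" and v: "v \<in> ?W" and close: "Delta2 \<Delta> (d i) (\<Phi> v) (\<Phi> w) \<le> \<epsilon>" for v w
      proof -
        let ?S = "\<lambda>w. {j. \<not> (x (\<Psi> w j \<one>) \<in> Q \<and> \<alpha> (x (\<Psi> w j \<one>)) = \<pi> (\<Psi> w j \<one>))}"
        let ?D = "\<lambda>w f. {j. s \<le> \<Delta> ((\<Phi> w \<circ> \<sigma> i f) j) ((act f \<circ> \<Phi> w) j)}"
        let ?E = "\<lambda>f. {j. s \<le> \<Delta> (\<Phi> v (\<sigma> i f j)) (\<Phi> w (\<sigma> i f j))}"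
        have "freq (d i) {j. w j \<noteq> v j}
            \<le> freq (d i) ((?S w \<union> ?S v) \<union> (\<Union>f\<in>F0. (?D w f \<union> ?D v f) \<union> ?E f))"
        proof (rule freq_mono[OF d_pos], rule ccontr)
          fix j assume j: "j \<in> {1..d i}" "j \<in> {j. w j \<noteq> v j}"
            and nj: "j \<notin> (?S w \<union> ?S v) \<union> (\<Union>f\<in>F0. (?D w f \<union> ?D v f) \<union> ?E f)"
          have lbl: "\<Phi> u j \<in> Q" "\<alpha> (\<Phi> u j) = u j" if u: "u \<in> ?W" "j \<notin> ?S u" for u
            using u(2) j(1) fun_cong[OF \<Psi>(2)[OF u(1)], of j] by (auto simp: \<Phi>_def)
          have inK: "u j \<in> A" "\<Phi> u j \<in> K (u j)" if u: "u \<in> ?W" "j \<notin> ?S u" for u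
          proof -
            obtain a where "a \<in> A" "\<Phi> u j \<in> K a" using lbl(1)[OF u] by (auto simp: Q_def)
            moreover have "a = u j" using calculation K(2) lbl(2)[OF u] by auto
            ultimately show "u j \<in> A" "\<Phi> u j \<in> K (u j)" by auto
          qed
          \<comment> \<open>Each translate is compared through index \<open>\<sigma> i f j\<close>:
            equivariance of one model, closeness of the two models there, equivariance of the other.
            Both points lie in cores, and cores of different labels are never this near, so the
            labels agree.\<close>
          have "near F0 r (\<Phi> w j) (\<Phi> v j)"
            unfolding near_def
          proof
            fix f assume f: "f \<in> F0"
            have "\<Delta> (\<Phi> w (\<sigma> i f j)) (act f (\<Phi> w j)) < s" "\<Delta> (\<Phi> v (\<sigma> i f j)) (act f (\<Phi> v j)) < s"
              "\<Delta> (\<Phi> v (\<sigma> i f j)) (\<Phi> w (\<sigma> i f j)) < s"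
              using nj f by auto
            moreover have "\<Delta> (act f (\<Phi> w j)) (act f (\<Phi> v j))
                \<le> \<Delta> (act f (\<Phi> w j)) (\<Phi> w (\<sigma> i f j)) + \<Delta> (\<Phi> w (\<sigma> i f j)) (\<Phi> v (\<sigma> i f j))
                  + \<Delta> (\<Phi> v (\<sigma> i f j)) (act f (\<Phi> v j))"
              by (intro order_trans[OF \<Delta>_tri add_right_mono] \<Delta>_tri)
            ultimately show "\<Delta> (act f (\<Phi> w j)) (act f (\<Phi> v j)) < r"
              by (simp add: s_def \<Delta>_sym)
          qed
          then show False
            using sep[of "w j" "v j" "\<Phi> w j" "\<Phi> v j"] inK[OF w] inK[OF v] nj j(2) by blast
        qed
        also have "\<dots> \<le> (freq (d i) (?S w) + freq (d i) (?S v))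
            + (\<Sum>f\<in>F0. (freq (d i) (?D w f) + freq (d i) (?D v f)) + freq (d i) (?E f))"
          by (intro order_trans[OF freq_Un_le] add_mono freq_Un_le order_trans[OF freq_UN_le[OF F0(1)]] sum_mono
              order_refl)
        also have "\<dots> \<le> (\<kappa> / 4 + \<kappa> / 4) + (\<Sum>f\<in>F0. (\<epsilon>\<^sup>2 / s\<^sup>2 + \<epsilon>\<^sup>2 / s\<^sup>2) + \<epsilon>\<^sup>2 / s\<^sup>2)"
        proof (intro add_mono sum_mono)
          show "freq (d i) (?S w) \<le> \<kappa> / 4" "freq (d i) (?S v) \<le> \<kappa> / 4"
            using \<Phi>(2) w v by blast+
          fix f assume f: "f \<in> F0"
          have D: "freq (d i) (?D u f) \<le> \<epsilon>\<^sup>2 / s\<^sup>2" if "u \<in> ?W" for u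
          proof -
            have "Delta2 \<Delta> (d i) (\<Phi> u \<circ> \<sigma> i f) (act f \<circ> \<Phi> u) < min \<delta> \<epsilon>"
              using \<Phi>(1)[OF that] f by (auto simp: Map_mu_def)
            then have "Delta2 \<Delta> (d i) (\<Phi> u \<circ> \<sigma> i f) (act f \<circ> \<Phi> u) \<le> \<epsilon>" by simp
            then show ?thesis by (rule freq_ge_le_Delta2[OF d_pos s])
          qed
          show "freq (d i) (?D w f) \<le> \<epsilon>\<^sup>2 / s\<^sup>2" "freq (d i) (?D v f) \<le> \<epsilon>\<^sup>2 / s\<^sup>2"
            using D w v by blast+
          have "freq (d i) (?E f) = freq (d i) {j. s \<le> \<Delta> (\<Phi> v j) (\<Phi> w j)}"
            using f F0(2) by (intro freq_permutes[OF d_pos permutes_\<sigma>]) auto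
          also have "\<dots> \<le> \<epsilon>\<^sup>2 / s\<^sup>2" by (rule freq_ge_le_Delta2[OF d_pos s close])
          finally show "freq (d i) (?E f) \<le> \<epsilon>\<^sup>2 / s\<^sup>2" .
        qed
        also have "\<dots> \<le> \<kappa>" using \<epsilon>s \<kappa> by simp
        finally show ?thesis .
      qed
      let ?ball = "\<lambda>v. {w \<in> {1..d i} \<rightarrow>\<^sub>E A. freq (d i) {j. w j \<noteq> v j} \<le> \<kappa>}"
      \<comment> \<open>The words of a maximal separated family are centres of Hamming balls
        covering all words.\<close>
      have "?W \<subseteq> (\<Union>v\<in>V. ?ball v)"
      proof
        fix w assume w: "w \<in> ?W"
        obtain v where v: "v \<in> V" "Delta2 \<Delta> (d i) (\<Phi> v) (\<Phi> w) \<le> \<epsilon>" using V(3)[OF w] by blast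
        then have "w \<in> ?ball v" using Hamming[OF w _ v(2)] W_PiE[OF w] V(1) by blast
        then show "w \<in> (\<Union>v\<in>V. ?ball v)" using v(1) by blast
      qed
      moreover have "finite ({1..d i} \<rightarrow>\<^sub>E A)" using A by (intro finite_PiE) auto
      then have "finite (\<Union>v\<in>V. ?ball v)" using finV by simp
      ultimately have "card ?W \<le> card (\<Union>v\<in>V. ?ball v)" by (intro card_mono)
      also have "\<dots> \<le> (\<Sum>v\<in>V. card (?ball v))" by (rule card_UN_le[OF finV])
      finally have "real (card ?W) \<le> (\<Sum>v\<in>V. real (card (?ball v)))"
        by (simp flip: of_nat_sum)
      also have "\<dots> \<le> (\<Sum>v\<in>V. exp (\<eta> * real (d i)))" by (intro sum_mono ball d_pos)
      finally have "real (card ?W) \<le> exp (\<eta> * real (d i)) * real (card V)" by (simp add: mult.commute)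
      then show ?thesis by (rule log_card_le_add[OF _ cardV])
    qed
    have "h_obs G d \<sigma> act \<mu> \<pi> B \<beta> \<le> h_obs_loc G d \<sigma> act \<mu> \<pi> B \<beta> F' \<delta>'"
      unfolding h_obs_def using F' \<delta>' by (intro INF_lower2[of F'] INF_lower2[of \<delta>']) auto
    also have "\<dots> \<le> limsup (\<lambda>i. ereal \<eta> + ereal (1 / real (d i)) *
        log_card (sep_number \<epsilon> (Map_mu act \<mu> \<Delta> F \<delta> L (d i) (\<sigma> i)) (Delta2 \<Delta> (d i))))"
      unfolding h_obs_loc_def
    proof (intro Limsup_mono always_eventually allI)
      fix i
      let ?X = "log_card (sep_number \<epsilon> (Map_mu act \<mu> \<Delta> F \<delta> L (d i) (\<sigma> i)) (Delta2 \<Delta> (d i)))"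
      have "ereal (1 / real (d i)) * log_card (enat (card
          ((\<lambda>\<psi>. \<lambda>j\<in>{1..d i}. \<pi> (\<psi> j \<one>)) ` AP G act \<mu> B \<beta> F' \<delta>' (d i) (\<sigma> i))))
        \<le> ereal (1 / real (d i)) * (ereal (\<eta> * real (d i)) + ?X)"
        by (intro ereal_mult_left_mono bound) simp
      also have "\<dots> = ereal (1 / real (d i)) * ereal (\<eta> * real (d i)) + ereal (1 / real (d i)) * ?X"
        by (rule ereal_pos_distrib) auto
      also have "ereal (1 / real (d i)) * ereal (\<eta> * real (d i)) = ereal \<eta>"
        using d_pos[of i] by simp
      finally show "ereal (1 / real (d i)) * log_card (enat (card
          ((\<lambda>\<psi>. \<lambda>j\<in>{1..d i}. \<pi> (\<psi> j \<one>)) ` AP G act \<mu> B \<beta> F' \<delta>' (d i) (\<sigma> i))))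
        \<le> ereal \<eta> + ereal (1 / real (d i)) * ?X" .
    qed
    also have "\<dots> = ereal \<eta> + h_Delta_loc d \<sigma> act \<mu> \<Delta> \<epsilon> F \<delta> L"
      unfolding h_Delta_loc_def by (intro Limsup_add_ereal_left) auto
    finally show ?thesis using \<beta> ref by blast
  qed
  with \<epsilon> show ?thesis by blast
qed

text \<open>Because \<epsilon> is independent of \<open>F\<close>, \<delta> and \<open>L\<close>,
  the bound survives the infimum over them; \<eta> is arbitrary and is removed at the end by
  \<open>ereal_le_epsilon2\<close>.\<close>

lemma sofic_measure_entropy_le: "sofic_measure_entropy G d \<sigma> act \<mu> \<le> h_Delta G d \<sigma> act \<mu> \<Delta>"
  unfolding sofic_measure_entropy_def
proof (rule SUP_least, clarify, rule ereal_le_epsilon2)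
  fix A :: "nat set" and \<alpha> :: "'x \<Rightarrow> nat" and \<eta> :: real
  assume \<alpha>: "observable \<mu> A \<alpha>" and \<eta>: "0 < \<eta>"
  define X where "X = (INF (B, \<beta>, \<pi>) \<in> {(B :: nat set, \<beta>, \<pi>). observable \<mu> B \<beta> \<and> refines_via \<mu> A \<alpha> B \<beta> \<pi>}.
      h_obs G d \<sigma> act \<mu> \<pi> B \<beta>)"
  obtain \<epsilon> where \<epsilon>: "0 < \<epsilon>" and le: "\<And>F \<delta> (L :: ('x \<Rightarrow>\<^sub>C real) set).
    finite F \<Longrightarrow> F \<subseteq> carrier G \<Longrightarrow> 0 < \<delta> \<Longrightarrow> finite L \<Longrightarrow>
    \<exists>B (\<beta> :: 'x \<Rightarrow> nat) \<pi>. observable \<mu> B \<beta> \<and> refines_via \<mu> A \<alpha> B \<beta> \<pi> \<and>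
      h_obs G d \<sigma> act \<mu> \<pi> B \<beta> \<le> ereal \<eta> + h_Delta_loc d \<sigma> act \<mu> \<Delta> \<epsilon> F \<delta> L"
    using ex_eps_h_obs_le[OF \<alpha> \<eta>] by blast
  \<comment> \<open>Moving the finite \<eta> to the left leaves a lower bound free of
    \<open>F\<close>, \<delta> and \<open>L\<close>, to which the greatest-lower-bound property
    applies.\<close>
  have "X - ereal \<eta> \<le> h_Delta_eps G d \<sigma> act \<mu> \<Delta> \<epsilon>"
    unfolding h_Delta_eps_def
  proof (intro INF_greatest)
    fix F \<delta> and L :: "('x \<Rightarrow>\<^sub>C real) set"
    assume "F \<in> {F. finite F \<and> F \<subseteq> carrier G}" "\<delta> \<in> {0::real<..}" "L \<in> {L. finite L}"
    then obtain B and \<beta> :: "'x \<Rightarrow> nat" and \<pi> where *: "observable \<mu> B \<beta>" "refines_via \<mu> A \<alpha> B \<beta> \<pi>"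
      and "h_obs G d \<sigma> act \<mu> \<pi> B \<beta> \<le> ereal \<eta> + h_Delta_loc d \<sigma> act \<mu> \<Delta> \<epsilon> F \<delta> L"
      using le[of F \<delta> L] by auto
    moreover have "X \<le> h_obs G d \<sigma> act \<mu> \<pi> B \<beta>"
      unfolding X_def using * by (intro INF_lower2[of "(B, \<beta>, \<pi>)"]) auto
    ultimately have "X \<le> h_Delta_loc d \<sigma> act \<mu> \<Delta> \<epsilon> F \<delta> L + ereal \<eta>"
      by (metis add.commute order_trans)
    then show "X - ereal \<eta> \<le> h_Delta_loc d \<sigma> act \<mu> \<Delta> \<epsilon> F \<delta> L"
      by (simp add: ereal_minus_le_iff)
  qed
  also have "\<dots> \<le> h_Delta G d \<sigma> act \<mu> \<Delta>"
    unfolding h_Delta_def using \<epsilon> by (intro SUP_upper) auto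
  finally show "X \<le> h_Delta G d \<sigma> act \<mu> \<Delta> + ereal \<eta>"
    by (simp add: ereal_minus_le_iff)
qed

end

theorem theorem3p12:
  fixes G :: "('g, 'm) monoid_scheme"
    and d :: "nat \<Rightarrow> nat"
    and \<sigma> :: "nat \<Rightarrow> 'g \<Rightarrow> nat \<Rightarrow> nat"
    and act :: "'g \<Rightarrow> 'x::polish_space \<Rightarrow> 'x"
    and \<mu> :: "'x measure"
    and \<Delta> :: "'x \<Rightarrow> 'x \<Rightarrow> real"
  assumes "group G"
    and "countable (carrier G)"
    and "sofic_approximation G d \<sigma>"
    and "continuous_action G act"
    and "invariant_prob G act \<mu>"
    and "dynamically_generating G act \<Delta>"
  shows "h_Delta G d \<sigma> act \<mu> \<Delta> = sofic_measure_entropy G d \<sigma> act \<mu>"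
  proof -
  interpret group G by (rule assms(1))
  interpret entropy_setting G d \<sigma> act \<mu> \<Delta>
    using assms(3-6) by unfold_locales
  show ?thesis
    using h_Delta_le sofic_measure_entropy_le by (rule antisym)
qed

end
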